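(* Let $k$ be a commutative ring, let $\mathcal{C}$ and $\mathcal{B}$ be $k$-categories, and let $F:\mathcal{C}\to\mathcal{B}$ be a connected covering. Then $F$ is a Galois covering if and only if the fibre product $\mathcal{C}\times_{\mathcal{B}}\mathcal{C}$ of $F$ with itself is a trivial covering of $\mathcal{C}$ with respect to the projection functor $\mathsf{pr}_{\mathcal{C}}:\mathcal{C}\times_{\mathcal{B}}\mathcal{C}\to\mathcal{C}$ to the first factor.
   Context: A $k$-category $\mathcal{B}$ is a small category with object set $\mathcal{B}_0$ such that each morphism set ${}_y\mathcal{B}_x$ (morphisms from $x$ to $y$) is a $k$-module and composition is $k$-bilinear. A $k$-functor is a $k$-linear functor. The star of $\mathcal{B}$ at an object $b$ is the $k$-module $\mathsf{St}_b\mathcal{B}=\left(\bigoplus_{y\in\mathcal{B}_0}{}_y\mathcal{B}_b\right)\oplus\left(\bigoplus_{y\in\mathcal{B}_0}{}_b\mathcal{B}_y\right)$. A $k$-functor $F:\mathcal{C}\to\mathcal{B}$ is a covering (of $\mathcal{B}$) if it is surjective on objects and, for each $b\in\mathcal{B}_0$ and each object $x\in F^{-1}(b)$, the map $\mathsf{St}_x\mathcal{C}\to\mathsf{St}_b\mathcal{B}$ induced by $F$ is an isomorphism of $k$-modules. A $k$-category is connected if any two objects can be joined by a non-zero walk, i.e. a finite sequence of non-zero morphisms, each traversed forwards or backwards, consecutive ones having matching endpoints. A covering $F:\mathcal{C}\to\mathcal{B}$ is connected if $\mathcal{C}$ is connected. $\mathrm{Aut}_1(F)$ is the group of invertible $k$-linear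 endofunctors $H$ of $\mathcal{C}$ with $FH=F$. A covering $F:\mathcal{C}\to\mathcal{B}$ is a Galois covering if $\mathcal{C}$ is connected and $\mathrm{Aut}_1(F)$ acts transitively on some fibre $F^{-1}(b)$, $b\in\mathcal{B}_0$. Given $k$-functors $F:\mathcal{C}\to\mathcal{B}$ and $G:\mathcal{D}\to\mathcal{B}$, the fibre product $\mathcal{C}\times_{\mathcal{B}}\mathcal{D}$ is the $k$-category whose objects are the pairs $(x,y)\in\mathcal{C}_0\times\mathcal{D}_0$ with $F(x)=G(y)$, whose morphisms from $(x,y)$ to $(x',y')$ form the $k$-submodule of ${}_{x'}\mathcal{C}_x\oplus{}_{y'}\mathcal{D}_y$ of pairs $(\varphi,\psi)$ with $F\varphi=G\psi$, and whose composition is componentwise. A trivial covering of a $k$-category $\mathcal{A}$ is a covering isomorphic to the projection $\mathcal{A}\times E\to\mathcal{A}$ for some set $E$, where $\mathcal{A}\times E$ has objects $\mathcal{A}_0\times E$ and morphisms ${}_{(y,e)}(\mathcal{A}\times E)_{(x,e)}={}_y\mathcal{A}_x$, and ${}_{(y,f)}(\mathcal{A}\times E)_{(x,e)}=0$ if $e\neq f$. Here a morphism from a covering $F:\mathcal{C}\to\mathcal{A}$ to a covering $G:\mathcal{D}\to\mathcal{A}$ is a pair $(H,J)$ of $k$-linear functors $H:\mathcal{C}\to\mathcal{D}$, $J:\mathcal{A}\to\mathcal{A}$ with $J$ an isomorphism and $GH=JF$; it is an isomorphism of coverings if $H$ is an isomorphism. *)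

theory Defs
  imports "HOL-Algebra.Module" "HOL-Library.FuncSet"
begin

section \<open>Modules\<close>

text \<open>
  The \<^const>\<open>mult\<close> and \<^const>\<open>one\<close> fields of a \<^typ>\<open>('k, 'm) module\<close> record are not
  constrained by the locale \<^locale>\<open>module\<close>; they are left undefined throughout.
\<close>

definition klinear ::
  "'k ring \<Rightarrow> ('k, 'm) module \<Rightarrow> ('k, 'n) module \<Rightarrow> ('m \<Rightarrow> 'n) \<Rightarrow> bool"
  where
  "klinear k M N f \<longleftrightarrow>
     f \<in> carrier M \<rightarrow> carrier N \<and>
     (\<forall>u\<in>carrier M. \<forall>v\<in>carrier M. f (u \<oplus>\<^bsub>M\<^esub> v) = f u \<oplus>\<^bsub>N\<^esub> f v) \<and>
     (\<forall>a\<in>carrier k. \<forall>u\<in>carrier M. f (a \<odot>\<^bsub>M\<^esub> u) = a \<odot>\<^bsub>N\<^esub> f u)"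

definition module_iso ::
  "'k ring \<Rightarrow> ('k, 'm) module \<Rightarrow> ('k, 'n) module \<Rightarrow> ('m \<Rightarrow> 'n) \<Rightarrow> bool"
  where
  "module_iso k M N f \<longleftrightarrow> klinear k M N f \<and> bij_betw f (carrier M) (carrier N)"

definition dirsum2 ::
  "('k, 'm) module \<Rightarrow> ('k, 'n) module \<Rightarrow> ('k, 'm \<times> 'n) module"
  where
  "dirsum2 M N =
     \<lparr> carrier = carrier M \<times> carrier N,
       mult = undefined,
       one = undefined,
       zero = (\<zero>\<^bsub>M\<^esub>, \<zero>\<^bsub>N\<^esub>),
       add = (\<lambda>(u, v) (u', v'). (u \<oplus>\<^bsub>M\<^esub> u', v \<oplus>\<^bsub>N\<^esub> v')),
       smult = (\<lambda>a (u, v). (a \<odot>\<^bsub>M\<^esub> u, a \<odot>\<^bsub>N\<^esub> v)) \<rparr>"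

definition dirsum ::
  "'i set \<Rightarrow> ('i \<Rightarrow> ('k, 'm) module) \<Rightarrow> ('k, 'i \<Rightarrow> 'm) module"
  where
  "dirsum I M =
     \<lparr> carrier = {u \<in> (\<Pi>\<^sub>E i\<in>I. carrier (M i)). finite {i \<in> I. u i \<noteq> \<zero>\<^bsub>M i\<^esub>}},
       mult = undefined,
       one = undefined,
       zero = (\<lambda>i\<in>I. \<zero>\<^bsub>M i\<^esub>),
       add = (\<lambda>u v. \<lambda>i\<in>I. u i \<oplus>\<^bsub>M i\<^esub> v i),
       smult = (\<lambda>a u. \<lambda>i\<in>I. a \<odot>\<^bsub>M i\<^esub> u i) \<rparr>"


section \<open>k-categories and k-functors\<close>

text \<open>
  \<open>mor B x y\<close> is the module of morphisms from \<open>x\<close> to \<open>y\<close>, and \<open>cmp B x y z g f\<close> is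
  \<open>g \<circ> f\<close> for \<open>f \<in> mor B x y\<close> and \<open>g \<in> mor B y z\<close>.  The morphism modules are a family
  indexed by pairs of objects: the carriers of different members need not be disjoint, and
  therefore composition and the action of a functor on morphisms take the objects as arguments.
\<close>

record ('k, 'o, 'm) kcat =
  obj :: "'o set"
  mor :: "'o \<Rightarrow> 'o \<Rightarrow> ('k, 'm) module"
  cmp :: "'o \<Rightarrow> 'o \<Rightarrow> 'o \<Rightarrow> 'm \<Rightarrow> 'm \<Rightarrow> 'm"
  idn :: "'o \<Rightarrow> 'm"

locale k_category = cring k for k :: "'k ring" +
  fixes B :: "('k, 'o, 'm) kcat"
  assumes mor_module:
      "\<lbrakk>x \<in> obj B; y \<in> obj B\<rbrakk> \<Longrightarrow> module k (mor B x y)"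
    and cmp_linear_left:
      "\<lbrakk>x \<in> obj B; y \<in> obj B; z \<in> obj B; f \<in> carrier (mor B x y)\<rbrakk>
        \<Longrightarrow> klinear k (mor B y z) (mor B x z) (\<lambda>g. cmp B x y z g f)"
    and cmp_linear_right:
      "\<lbrakk>x \<in> obj B; y \<in> obj B; z \<in> obj B; g \<in> carrier (mor B y z)\<rbrakk>
        \<Longrightarrow> klinear k (mor B x y) (mor B x z) (\<lambda>f. cmp B x y z g f)"
    and cmp_assoc:
      "\<lbrakk>w \<in> obj B; x \<in> obj B; y \<in> obj B; z \<in> obj B;
        f \<in> carrier (mor B w x); g \<in> carrier (mor B x y); h \<in> carrier (mor B y z)\<rbrakk>
        \<Longrightarrow> cmp B w y z h (cmp B w x y g f) = cmp B w x z (cmp B x y z h g) f"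
    and idn_closed:
      "x \<in> obj B \<Longrightarrow> idn B x \<in> carrier (mor B x x)"
    and cmp_idn_left:
      "\<lbrakk>x \<in> obj B; y \<in> obj B; f \<in> carrier (mor B x y)\<rbrakk> \<Longrightarrow> cmp B x y y (idn B y) f = f"
    and cmp_idn_right:
      "\<lbrakk>x \<in> obj B; y \<in> obj B; f \<in> carrier (mor B x y)\<rbrakk> \<Longrightarrow> cmp B x x y f (idn B x) = f"

record ('o, 'm, 'p, 'n) kfun =
  fobj :: "'o \<Rightarrow> 'p"
  fmor :: "'o \<Rightarrow> 'o \<Rightarrow> 'm \<Rightarrow> 'n"

locale k_functor = C: k_category k C + D: k_category k D
  for k :: "'k ring"
  and C :: "('k, 'o, 'm) kcat"
  and D :: "('k, 'p, 'n) kcat" +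
  fixes F :: "('o, 'm, 'p, 'n) kfun"
  assumes fobj_closed:
      "x \<in> obj C \<Longrightarrow> fobj F x \<in> obj D"
    and fmor_linear:
      "\<lbrakk>x \<in> obj C; y \<in> obj C\<rbrakk>
        \<Longrightarrow> klinear k (mor C x y) (mor D (fobj F x) (fobj F y)) (fmor F x y)"
    and fmor_cmp:
      "\<lbrakk>x \<in> obj C; y \<in> obj C; z \<in> obj C; f \<in> carrier (mor C x y); g \<in> carrier (mor C y z)\<rbrakk>
        \<Longrightarrow> fmor F x z (cmp C x y z g f) =
            cmp D (fobj F x) (fobj F y) (fobj F z) (fmor F y z g) (fmor F x y f)"
    and fmor_idn:
      "x \<in> obj C \<Longrightarrow> fmor F x x (idn C x) = idn D (fobj F x)"

definition id_kfun :: "('o, 'm, 'o, 'm) kfun"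
  where "id_kfun = \<lparr> fobj = (\<lambda>x. x), fmor = (\<lambda>x y f. f) \<rparr>"

definition comp_kfun ::
  "('p, 'n, 'q, 'l) kfun \<Rightarrow> ('o, 'm, 'p, 'n) kfun \<Rightarrow> ('o, 'm, 'q, 'l) kfun"
  where
  "comp_kfun G F =
     \<lparr> fobj = (\<lambda>x. fobj G (fobj F x)),
       fmor = (\<lambda>x y f. fmor G (fobj F x) (fobj F y) (fmor F x y f)) \<rparr>"

text \<open>
  Equality of functors with source \<open>C\<close>.  Values outside the objects and morphisms of \<open>C\<close>
  carry no information, so they are disregarded.
\<close>

definition kfun_eq ::
  "('k, 'o, 'm) kcat \<Rightarrow> ('o, 'm, 'p, 'n) kfun \<Rightarrow> ('o, 'm, 'p, 'n) kfun \<Rightarrow> bool"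
  where
  "kfun_eq C F G \<longleftrightarrow>
     (\<forall>x\<in>obj C. fobj F x = fobj G x) \<and>
     (\<forall>x\<in>obj C. \<forall>y\<in>obj C. \<forall>f\<in>carrier (mor C x y). fmor F x y f = fmor G x y f)"

definition kcat_iso ::
  "'k ring \<Rightarrow> ('k, 'o, 'm) kcat \<Rightarrow> ('k, 'p, 'n) kcat \<Rightarrow> ('o, 'm, 'p, 'n) kfun \<Rightarrow> bool"
  where
  "kcat_iso k C D H \<longleftrightarrow>
     k_functor k C D H \<and>
     (\<exists>H'. k_functor k D C H' \<and>
           kfun_eq C (comp_kfun H' H) id_kfun \<and> kfun_eq D (comp_kfun H H') id_kfun)"


section \<open>Connected k-categories\<close>

text \<open>Non-zero walks, including the empty walk at each object.\<close>

inductive nonzero_walk :: "('k, 'o, 'm) kcat \<Rightarrow> 'o \<Rightarrow> 'o \<Rightarrow> bool"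
  for C :: "('k, 'o, 'm) kcat"
  where
  empty: "x \<in> obj C \<Longrightarrow> nonzero_walk C x x"
| forward:
    "\<lbrakk>nonzero_walk C x y; z \<in> obj C; f \<in> carrier (mor C y z); f \<noteq> \<zero>\<^bsub>mor C y z\<^esub>\<rbrakk>
      \<Longrightarrow> nonzero_walk C x z"
| backward:
    "\<lbrakk>nonzero_walk C x y; z \<in> obj C; f \<in> carrier (mor C z y); f \<noteq> \<zero>\<^bsub>mor C z y\<^esub>\<rbrakk>
      \<Longrightarrow> nonzero_walk C x z"

definition kcat_connected :: "('k, 'o, 'm) kcat \<Rightarrow> bool"
  where "kcat_connected C \<longleftrightarrow> (\<forall>x\<in>obj C. \<forall>y\<in>obj C. nonzero_walk C x y)"


section \<open>Coverings\<close>

definition fibre ::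
  "('k, 'o, 'm) kcat \<Rightarrow> ('o, 'm, 'p, 'n) kfun \<Rightarrow> 'p \<Rightarrow> 'o set"
  where "fibre C F b = {x \<in> obj C. fobj F x = b}"

text \<open>
  The first summand of the star consists of the morphisms starting at \<open>b\<close>, the second one of
  those ending at \<open>b\<close>; endomorphisms of \<open>b\<close> occur in both.
\<close>

definition star ::
  "('k, 'o, 'm) kcat \<Rightarrow> 'o \<Rightarrow> ('k, ('o \<Rightarrow> 'm) \<times> ('o \<Rightarrow> 'm)) module"
  where
  "star B b = dirsum2 (dirsum (obj B) (\<lambda>y. mor B b y)) (dirsum (obj B) (\<lambda>y. mor B y b))"

text \<open>
  The component at \<open>c\<close> of the image of a family under \<open>F\<close> is the sum of the images of its
  components at the objects above \<open>c\<close>.  The sum is taken over the support of the family,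
  because \<^const>\<open>finsum\<close> is only meaningful over finite index sets.
\<close>

definition star_map ::
  "('k, 'o, 'm) kcat \<Rightarrow> ('k, 'p, 'n) kcat \<Rightarrow> ('o, 'm, 'p, 'n) kfun \<Rightarrow> 'o \<Rightarrow>
   ('o \<Rightarrow> 'm) \<times> ('o \<Rightarrow> 'm) \<Rightarrow> ('p \<Rightarrow> 'n) \<times> ('p \<Rightarrow> 'n)"
  where
  "star_map C B F x = (\<lambda>(u, v).
     (\<lambda>c\<in>obj B. finsum (mor B (fobj F x) c) (\<lambda>y. fmor F x y (u y))
                  {y \<in> fibre C F c. u y \<noteq> \<zero>\<^bsub>mor C x y\<^esub>},
      \<lambda>c\<in>obj B. finsum (mor B c (fobj F x)) (\<lambda>y. fmor F y x (v y))
                  {y \<in> fibre C F c. v y \<noteq> \<zero>\<^bsub>mor C y x\<^esub>}))"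

definition k_covering ::
  "'k ring \<Rightarrow> ('k, 'o, 'm) kcat \<Rightarrow> ('k, 'p, 'n) kcat \<Rightarrow> ('o, 'm, 'p, 'n) kfun \<Rightarrow> bool"
  where
  "k_covering k C B F \<longleftrightarrow>
     k_functor k C B F \<and>
     fobj F ` obj C = obj B \<and>
     (\<forall>b\<in>obj B. \<forall>x\<in>fibre C F b. module_iso k (star C x) (star B b) (star_map C B F x))"

definition connected_covering ::
  "'k ring \<Rightarrow> ('k, 'o, 'm) kcat \<Rightarrow> ('k, 'p, 'n) kcat \<Rightarrow> ('o, 'm, 'p, 'n) kfun \<Rightarrow> bool"
  where "connected_covering k C B F \<longleftrightarrow> k_covering k C B F \<and> kcat_connected C"

definition Aut1 ::
  "'k ring \<Rightarrow> ('k, 'o, 'm) kcat \<Rightarrow> ('o, 'm, 'p, 'n) kfun \<Rightarrow> ('o, 'm, 'o, 'm) kfun set"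
  where "Aut1 k C F = {H. kcat_iso k C C H \<and> kfun_eq C (comp_kfun F H) F}"

definition galois_covering ::
  "'k ring \<Rightarrow> ('k, 'o, 'm) kcat \<Rightarrow> ('k, 'p, 'n) kcat \<Rightarrow> ('o, 'm, 'p, 'n) kfun \<Rightarrow> bool"
  where
  "galois_covering k C B F \<longleftrightarrow>
     k_covering k C B F \<and> kcat_connected C \<and>
     (\<exists>b\<in>obj B. \<forall>x\<in>fibre C F b. \<forall>y\<in>fibre C F b. \<exists>H\<in>Aut1 k C F. fobj H x = y)"


section \<open>Fibre products\<close>

definition fibre_product ::
  "('k, 'o, 'm) kcat \<Rightarrow> ('k, 'q, 'l) kcat \<Rightarrow>
   ('o, 'm, 'p, 'n) kfun \<Rightarrow> ('q, 'l, 'p, 'n) kfun \<Rightarrow> ('k, 'o \<times> 'q, 'm \<times> 'l) kcat"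
  where
  "fibre_product C D F G =
     \<lparr> obj = {(x, y). x \<in> obj C \<and> y \<in> obj D \<and> fobj F x = fobj G y},
       mor = (\<lambda>(x, y) (x', y').
         (dirsum2 (mor C x x') (mor D y y'))
           \<lparr> carrier := {(\<phi>, \<psi>). \<phi> \<in> carrier (mor C x x') \<and> \<psi> \<in> carrier (mor D y y') \<and>
                                 fmor F x x' \<phi> = fmor G y y' \<psi>} \<rparr>),
       cmp = (\<lambda>(x, y) (x', y') (x'', y'') (\<phi>', \<psi>') (\<phi>, \<psi>).
         (cmp C x x' x'' \<phi>' \<phi>, cmp D y y' y'' \<psi>' \<psi>)),
       idn = (\<lambda>(x, y). (idn C x, idn D y)) \<rparr>"

definition pr_first :: "('o \<times> 'q, 'm \<times> 'l, 'o, 'm) kfun"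
  where "pr_first = \<lparr> fobj = fst, fmor = (\<lambda>_ _. fst) \<rparr>"


section \<open>Trivial coverings\<close>

definition kcat_times :: "('k, 'o, 'm) kcat \<Rightarrow> 'e set \<Rightarrow> ('k, 'o \<times> 'e, 'm) kcat"
  where
  "kcat_times A E =
     \<lparr> obj = obj A \<times> E,
       mor = (\<lambda>(x, e) (y, f).
         if e = f then mor A x y else (mor A x y)\<lparr> carrier := {\<zero>\<^bsub>mor A x y\<^esub>} \<rparr>),
       cmp = (\<lambda>(x, e) (y, f) (z, g). cmp A x y z),
       idn = (\<lambda>(x, e). idn A x) \<rparr>"

definition kcat_times_proj :: "('o \<times> 'e, 'm, 'o, 'm) kfun"
  where "kcat_times_proj = \<lparr> fobj = fst, fmor = (\<lambda>_ _ f. f) \<rparr>"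

text \<open>Coverings \<open>F : C \<rightarrow> A\<close> and \<open>G : D \<rightarrow> A\<close> of the same category \<open>A\<close>.\<close>

definition covering_morphism ::
  "'k ring \<Rightarrow> ('k, 'a, 'l) kcat \<Rightarrow>
   ('k, 'o, 'm) kcat \<Rightarrow> ('o, 'm, 'a, 'l) kfun \<Rightarrow>
   ('k, 'p, 'n) kcat \<Rightarrow> ('p, 'n, 'a, 'l) kfun \<Rightarrow>
   ('o, 'm, 'p, 'n) kfun \<Rightarrow> ('a, 'l, 'a, 'l) kfun \<Rightarrow> bool"
  where
  "covering_morphism k A C F D G H J \<longleftrightarrow>
     k_functor k C D H \<and> kcat_iso k A A J \<and> kfun_eq C (comp_kfun G H) (comp_kfun J F)"

definition isomorphic_coverings ::
  "'k ring \<Rightarrow> ('k, 'a, 'l) kcat \<Rightarrow>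
   ('k, 'o, 'm) kcat \<Rightarrow> ('o, 'm, 'a, 'l) kfun \<Rightarrow>
   ('k, 'p, 'n) kcat \<Rightarrow> ('p, 'n, 'a, 'l) kfun \<Rightarrow> bool"
  where
  "isomorphic_coverings k A C F D G \<longleftrightarrow>
     (\<exists>H J. covering_morphism k A C F D G H J \<and> kcat_iso k C D H)"

text \<open>
  The set \<open>E\<close> is taken in the type of the objects of \<open>D\<close>.  This is no restriction: an
  isomorphism \<open>D \<cong> A \<times> E\<close> embeds \<open>E\<close> into the objects of \<open>D\<close> whenever \<open>A\<close> has an object,
  replacing \<open>E\<close> by a set in bijection with it does not change \<open>A \<times> E\<close> up to isomorphism over
  \<open>A\<close>, and if \<open>A\<close> has no object then \<open>A \<times> E\<close> does not depend on \<open>E\<close>.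
\<close>

definition trivial_covering ::
  "'k ring \<Rightarrow> ('k, 'd, 'n) kcat \<Rightarrow> ('k, 'a, 'l) kcat \<Rightarrow> ('d, 'n, 'a, 'l) kfun \<Rightarrow> bool"
  where
  "trivial_covering k D A G \<longleftrightarrow>
     k_covering k D A G \<and>
     (\<exists>E :: 'd set. isomorphic_coverings k A D G (kcat_times A E) kcat_times_proj)"

end

theory Submission
  imports Defs
begin

text \<open>
  The covering condition says that a morphism of \<open>B\<close> lifts uniquely to a finite sum of morphisms
  that start at (or that end at) a given object over its source (or target).  In particular \<open>F\<close>
  is faithful, and a non-zero morphism has at most one homogeneous lift at a given object.
  For connected \<open>C\<close> it follows that an endofunctor of \<open>C\<close> over \<open>B\<close> is determined by its value at
  one object (\<open>deck_endo_unique\<close>), and that transitivity of the deck transformations spreads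
  from one fibre to all fibres (\<open>orbit_is_fibre_step\<close>).

  Each deck transformation \<open>T\<close> embeds \<open>C\<close> into the fibre product as its graph
  \<open>x \<mapsto> (x, T x)\<close>, a section of the first projection.  By uniqueness of lifts, different graphs are
  disjoint and there are no non-zero morphisms between them (\<open>square_morphism_graph\<close>).

  If \<open>F\<close> is Galois, the graphs exhaust the fibre product, which is thus the disjoint union of
  copies of \<open>C\<close>, one for each deck transformation (\<open>trivial_if_orbits_are_fibres\<close>).

  Conversely, in a trivialisation of the fibre product the sheet through \<open>(x, y)\<close> is the graph of
  an endofunctor over \<open>B\<close> that maps \<open>x\<close> to \<open>y\<close> (\<open>deck_endo_if_trivial\<close>).  The sheet through
  \<open>(y, x)\<close> gives one that undoes it at \<open>x\<close>, hence everywhere, so that the deck transformations act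
  transitively on every fibre (\<open>orbits_are_fibres_if_trivial\<close>).
\<close>

section \<open>Linear maps between direct sums\<close>

lemma klinearD:
  assumes "klinear k M N f"
  shows "u \<in> carrier M \<Longrightarrow> f u \<in> carrier N"
    and "u \<in> carrier M \<Longrightarrow> v \<in> carrier M \<Longrightarrow> f (u \<oplus>\<^bsub>M\<^esub> v) = f u \<oplus>\<^bsub>N\<^esub> f v"
    and "a \<in> carrier k \<Longrightarrow> u \<in> carrier M \<Longrightarrow> f (a \<odot>\<^bsub>M\<^esub> u) = a \<odot>\<^bsub>N\<^esub> f u"
  using assms by (auto simp: klinear_def)

lemma klinearI:
  assumes "\<And>u. u \<in> carrier M \<Longrightarrow> f u \<in> carrier N"
    and "\<And>u v. u \<in> carrier M \<Longrightarrow> v \<in> carrier M \<Longrightarrow> f (u \<oplus>\<^bsub>M\<^esub> v) = f u \<oplus>\<^bsub>N\<^esub> f v"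
    and "\<And>a u. a \<in> carrier k \<Longrightarrow> u \<in> carrier M \<Longrightarrow> f (a \<odot>\<^bsub>M\<^esub> u) = a \<odot>\<^bsub>N\<^esub> f u"
  shows "klinear k M N f"
  using assms by (auto simp: klinear_def)

lemma module_zero_closed: "module k M \<Longrightarrow> \<zero>\<^bsub>M\<^esub> \<in> carrier M"
  by (meson abelian_group.axioms(1) abelian_monoid.zero_closed module.axioms(2))

lemma klinear_zero:
  assumes "module k M" "module k N" "klinear k M N f"
  shows "f \<zero>\<^bsub>M\<^esub> = \<zero>\<^bsub>N\<^esub>"
proof -
  interpret M: module k M by fact
  interpret N: module k N by fact
  have "f \<zero>\<^bsub>M\<^esub> = f (\<zero>\<^bsub>k\<^esub> \<odot>\<^bsub>M\<^esub> \<zero>\<^bsub>M\<^esub>)" by simp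
  also have "\<dots> = \<zero>\<^bsub>k\<^esub> \<odot>\<^bsub>N\<^esub> f \<zero>\<^bsub>M\<^esub>" using klinearD(3)[OF assms(3)] M.R.zero_closed M.zero_closed by blast
  also have "\<dots> = \<zero>\<^bsub>N\<^esub>" using klinearD(1)[OF assms(3)] by simp
  finally show ?thesis .
qed

lemma klinear_comp:
  assumes "klinear k M N f" "klinear k N P g"
  shows "klinear k M P (\<lambda>u. g (f u))"
  using assms by (auto simp: klinear_def Pi_iff)

lemma finsum_one:
  assumes "module k P" "f i \<in> carrier P"
  shows "finsum P f {i} = f i"
proof -
  interpret P: module k P by fact
  show ?thesis using assms(2) P.finsum_insert[of "{}" i f] by simp
qed

lemma module_iso_dirsum2_iff:
  assumes "carrier M \<noteq> {}" "carrier M' \<noteq> {}"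
  shows "module_iso k (dirsum2 M M') (dirsum2 N N') (\<lambda>(u, v). (f u, g v)) \<longleftrightarrow>
         module_iso k M N f \<and> module_iso k M' N' g"
proof
  obtain m m' where m: "m \<in> carrier M" "m' \<in> carrier M'" using assms by blast
  assume iso: "module_iso k (dirsum2 M M') (dirsum2 N N') (\<lambda>(u, v). (f u, g v))"
  then have *: "klinear k (dirsum2 M M') (dirsum2 N N') (\<lambda>(u, v). (f u, g v))"
    and bij: "bij_betw (\<lambda>(u, v). (f u, g v)) (carrier M \<times> carrier M') (carrier N \<times> carrier N')"
    by (auto simp: module_iso_def dirsum2_def)
  have cl: "f u \<in> carrier N \<and> g v \<in> carrier N'" if "u \<in> carrier M" "v \<in> carrier M'" for u v
    using klinearD(1)[OF *, of "(u, v)"] that by (simp add: dirsum2_def)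
  have ad: "f (u \<oplus>\<^bsub>M\<^esub> u') = f u \<oplus>\<^bsub>N\<^esub> f u' \<and> g (v \<oplus>\<^bsub>M'\<^esub> v') = g v \<oplus>\<^bsub>N'\<^esub> g v'"
    if "u \<in> carrier M" "v \<in> carrier M'" "u' \<in> carrier M" "v' \<in> carrier M'" for u v u' v'
    using klinearD(2)[OF *, of "(u, v)" "(u', v')"] that by (simp add: dirsum2_def)
  have sm: "f (a \<odot>\<^bsub>M\<^esub> u) = a \<odot>\<^bsub>N\<^esub> f u \<and> g (a \<odot>\<^bsub>M'\<^esub> v) = a \<odot>\<^bsub>N'\<^esub> g v"
    if "a \<in> carrier k" "u \<in> carrier M" "v \<in> carrier M'" for u v a
    using klinearD(3)[OF *, of a "(u, v)"] that by (simp add: dirsum2_def)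
  have inj: "u = u' \<and> v = v'"
    if "f u = f u'" "g v = g v'" "u \<in> carrier M" "v \<in> carrier M'" "u' \<in> carrier M" "v' \<in> carrier M'"
    for u v u' v'
    using inj_onD[OF bij_betw_imp_inj_on[OF bij], of "(u, v)" "(u', v')"] that by simp
  have surj: "\<exists>u\<in>carrier M. \<exists>v\<in>carrier M'. f u = n \<and> g v = n'"
    if "n \<in> carrier N" "n' \<in> carrier N'" for n n'
  proof -
    have "(n, n') \<in> (\<lambda>(u, v). (f u, g v)) ` (carrier M \<times> carrier M')"
      using that bij_betw_imp_surj_on[OF bij] by auto
    then show ?thesis by auto
  qed
  have "bij_betw f (carrier M) (carrier N)"
    unfolding bij_betw_def inj_on_def using inj[of _ _ m' m'] surj[of _ "g m'"] cl m by blast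
  moreover have "bij_betw g (carrier M') (carrier N')"
    unfolding bij_betw_def inj_on_def using inj[of m m] surj[of "f m"] cl m by blast
  ultimately show "module_iso k M N f \<and> module_iso k M' N' g"
    unfolding module_iso_def klinear_def using cl ad sm m by blast
next
  assume *: "module_iso k M N f \<and> module_iso k M' N' g"
  then have bf: "bij_betw f (carrier M) (carrier N)" and bg: "bij_betw g (carrier M') (carrier N')"
    and "klinear k M N f" "klinear k M' N' g"
    by (auto simp: module_iso_def)
  then have "klinear k (dirsum2 M M') (dirsum2 N N') (\<lambda>(u, v). (f u, g v))"
    by (auto simp: klinear_def dirsum2_def)
  moreover have "bij_betw (\<lambda>(u, v). (f u, g v)) (carrier M \<times> carrier M') (carrier N \<times> carrier N')"
    using bij_betw_map_prod[OF bf bg] by (simp add: map_prod_def)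
  ultimately show "module_iso k (dirsum2 M M') (dirsum2 N N') (\<lambda>(u, v). (f u, g v))"
    by (simp add: module_iso_def dirsum2_def)
qed

text \<open>
  The family concentrated at one index.  These generate a direct sum, and a map between direct
  sums that sends each summand into one summand is determined by what it does to them.
\<close>

definition single :: "'i set \<Rightarrow> ('i \<Rightarrow> ('k, 'm) module) \<Rightarrow> 'i \<Rightarrow> 'm \<Rightarrow> 'i \<Rightarrow> 'm"
  where "single I M i m = (\<lambda>j\<in>I. if j = i then m else \<zero>\<^bsub>M j\<^esub>)"

text \<open>
  Both halves of the map between stars induced by a functor have the same shape: a family of
  linear maps \<open>\<phi> i : M i \<rightarrow> N (p i)\<close>, where several summands of the source may lie over the
  same summand of the target.  What bijectivity of the induced map on direct sums says about
  the individual \<open>\<phi> i\<close> has nothing to do with categories and is established at this level.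
\<close>

locale module_families =
  fixes k :: "'k ring"
    and I :: "'i set" and M :: "'i \<Rightarrow> ('k, 'm) module"
    and J :: "'j set" and N :: "'j \<Rightarrow> ('k, 'n) module"
    and p :: "'i \<Rightarrow> 'j" and \<phi> :: "'i \<Rightarrow> 'm \<Rightarrow> 'n"
  assumes M_module: "i \<in> I \<Longrightarrow> module k (M i)"
    and N_module: "j \<in> J \<Longrightarrow> module k (N j)"
    and p_closed: "i \<in> I \<Longrightarrow> p i \<in> J"
    and \<phi>_linear: "i \<in> I \<Longrightarrow> klinear k (M i) (N (p i)) (\<phi> i)"
begin

definition sum_map :: "('i \<Rightarrow> 'm) \<Rightarrow> 'j \<Rightarrow> 'n"
  where "sum_map u =
    (\<lambda>c\<in>J. finsum (N c) (\<lambda>i. \<phi> i (u i)) {i \<in> I. p i = c \<and> u i \<noteq> \<zero>\<^bsub>M i\<^esub>})"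

lemma \<phi>_zero: "i \<in> I \<Longrightarrow> \<phi> i \<zero>\<^bsub>M i\<^esub> = \<zero>\<^bsub>N (p i)\<^esub>"
  by (simp add: klinear_zero[OF M_module N_module \<phi>_linear] p_closed)

lemma \<phi>_closed: "i \<in> I \<Longrightarrow> m \<in> carrier (M i) \<Longrightarrow> \<phi> i m \<in> carrier (N (p i))"
  using klinearD(1)[OF \<phi>_linear] .

lemma single_closed:
  assumes "i \<in> I" "m \<in> carrier (M i)"
  shows "single I M i m \<in> carrier (dirsum I M)"
proof -
  have "finite {j \<in> I. single I M i m j \<noteq> \<zero>\<^bsub>M j\<^esub>}"
    by (rule finite_subset[of _ "{i}"]) (auto simp: single_def)
  then show ?thesis
    using assms by (auto simp: dirsum_def single_def module_zero_closed[OF M_module])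
qed

lemma single_target_closed:
  assumes "c \<in> J" "n \<in> carrier (N c)"
  shows "single J N c n \<in> carrier (dirsum J N)"
proof -
  have "finite {j \<in> J. single J N c n j \<noteq> \<zero>\<^bsub>N j\<^esub>}"
    by (rule finite_subset[of _ "{c}"]) (auto simp: single_def)
  then show ?thesis
    using assms by (auto simp: dirsum_def single_def module_zero_closed[OF N_module])
qed

lemma single_target_add:
  assumes "c \<in> J" "n \<in> carrier (N c)" "n' \<in> carrier (N c)"
  shows "single J N c n \<oplus>\<^bsub>dirsum J N\<^esub> single J N c n' = single J N c (n \<oplus>\<^bsub>N c\<^esub> n')"
proof -
  have "\<zero>\<^bsub>N j\<^esub> \<oplus>\<^bsub>N j\<^esub> \<zero>\<^bsub>N j\<^esub> = \<zero>\<^bsub>N j\<^esub>" if "j \<in> J" for j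
    using N_module[OF that] module_zero_closed
    by (metis abelian_group.axioms(1) abelian_monoid.l_zero module.axioms(2))
  then show ?thesis by (auto simp: dirsum_def single_def)
qed

lemma sum_map_single:
  assumes i: "i \<in> I" and m: "m \<in> carrier (M i)"
  shows "sum_map (single I M i m) = single J N (p i) (\<phi> i m)"
proof
  fix c
  show "sum_map (single I M i m) c = single J N (p i) (\<phi> i m) c"
  proof (cases "c \<in> J")
    case True
    interpret N: module k "N c" using N_module True .
    let ?S = "{j \<in> I. p j = c \<and> single I M i m j \<noteq> \<zero>\<^bsub>M j\<^esub>}"
    show ?thesis
    proof (cases "c = p i \<and> m \<noteq> \<zero>\<^bsub>M i\<^esub>")
      case c: True
      have S: "?S = {i}" using i c by (auto simp: single_def)
      have "finsum (N c) (\<lambda>j. \<phi> j (single I M i m j)) {i} = \<phi> i m"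
        using c i \<phi>_closed[OF i m] finsum_one[OF N_module[OF True], of "\<lambda>j. \<phi> j (single I M i m j)" i]
        by (simp add: single_def)
      then have "sum_map (single I M i m) c = \<phi> i m"
        unfolding sum_map_def restrict_apply S using True c by simp
      then show ?thesis using True c by (simp add: single_def)
    next
      case False
      then have S: "?S = {}" by (auto simp: single_def)
      show ?thesis
        using True False i \<phi>_zero[OF i] by (simp only: sum_map_def restrict_apply S) (auto simp: single_def)
    qed
  qed (auto simp: sum_map_def single_def)
qed

lemma dirsum_add_closed:
  assumes "u \<in> carrier (dirsum I M)" "v \<in> carrier (dirsum I M)"
  shows "u \<oplus>\<^bsub>dirsum I M\<^esub> v \<in> carrier (dirsum I M)"
proof -
  have *: "u i \<oplus>\<^bsub>M i\<^esub> v i \<in> carrier (M i)" "\<zero>\<^bsub>M i\<^esub> \<oplus>\<^bsub>M i\<^esub> \<zero>\<^bsub>M i\<^esub> = \<zero>\<^bsub>M i\<^esub>" if "i \<in> I" for i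
  proof -
    interpret module k "M i" using M_module that .
    show "u i \<oplus>\<^bsub>M i\<^esub> v i \<in> carrier (M i)" "\<zero>\<^bsub>M i\<^esub> \<oplus>\<^bsub>M i\<^esub> \<zero>\<^bsub>M i\<^esub> = \<zero>\<^bsub>M i\<^esub>"
      using assms that by (auto simp: dirsum_def)
  qed
  have "finite ({i \<in> I. u i \<noteq> \<zero>\<^bsub>M i\<^esub>} \<union> {i \<in> I. v i \<noteq> \<zero>\<^bsub>M i\<^esub>})"
    using assms by (auto simp: dirsum_def)
  then have "finite {i \<in> I. u i \<oplus>\<^bsub>M i\<^esub> v i \<noteq> \<zero>\<^bsub>M i\<^esub>}"
    by (rule finite_subset[rotated]) (auto simp: *)
  moreover have "{i \<in> I. (\<lambda>i\<in>I. u i \<oplus>\<^bsub>M i\<^esub> v i) i \<noteq> \<zero>\<^bsub>M i\<^esub>} = {i \<in> I. u i \<oplus>\<^bsub>M i\<^esub> v i \<noteq> \<zero>\<^bsub>M i\<^esub>}"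
    by auto
  ultimately show ?thesis using * by (auto simp: dirsum_def)
qed

lemma sum_map_faithful:
  assumes iso: "module_iso k (dirsum I M) (dirsum J N) sum_map"
    and i: "i \<in> I" and m: "m \<in> carrier (M i)" "m' \<in> carrier (M i)" and eq: "\<phi> i m = \<phi> i m'"
  shows "m = m'"
proof -
  have "single I M i m = single I M i m'"
  proof (rule inj_onD)
    show "inj_on sum_map (carrier (dirsum I M))" using iso by (simp add: module_iso_def bij_betw_def)
  qed (use i m eq in \<open>simp_all add: single_closed sum_map_single\<close>)
  from fun_cong[OF this, of i] show ?thesis using i by (simp add: single_def)
qed

text \<open>
  If the map between the direct sums is injective, a summand over \<open>c\<close> meets the sum of all the
  other summands over \<open>c\<close> trivially inside \<open>N c\<close>.  The elements \<open>g s\<close> may repeat summands, so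
  that no regrouping by index is needed when this is applied.
\<close>

lemma sum_map_separates:
  assumes iso: "module_iso k (dirsum I M) (dirsum J N) sum_map"
    and i: "i \<in> I" and m: "m \<in> carrier (M i)" and S: "finite S"
    and g: "\<And>s. s \<in> S \<Longrightarrow> \<alpha> s \<in> I \<and> \<alpha> s \<noteq> i \<and> p (\<alpha> s) = p i \<and> g s \<in> carrier (M (\<alpha> s))"
    and eq: "\<phi> i m = finsum (N (p i)) (\<lambda>s. \<phi> (\<alpha> s) (g s)) S"
  shows "m = \<zero>\<^bsub>M i\<^esub>"
proof -
  interpret N: module k "N (p i)" using N_module p_closed i by blast
  have lin: "klinear k (dirsum I M) (dirsum J N) sum_map"
    and bij: "bij_betw sum_map (carrier (dirsum I M)) (carrier (dirsum J N))"
    using iso by (auto simp: module_iso_def)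
  \<comment> \<open>The families that vanish at \<open>i\<close> are closed under addition, so their image contains the sum.\<close>
  have "\<exists>u\<in>carrier (dirsum I M). u i = \<zero>\<^bsub>M i\<^esub> \<and>
          sum_map u = single J N (p i) (finsum (N (p i)) (\<lambda>s. \<phi> (\<alpha> s) (g s)) S)"
    using S g
  proof (induction S rule: finite_induct)
    case empty
    let ?u = "single I M i \<zero>\<^bsub>M i\<^esub>"
    have "?u \<in> carrier (dirsum I M)" "?u i = \<zero>\<^bsub>M i\<^esub>"
      using i single_closed[OF i module_zero_closed[OF M_module[OF i]]] by (auto simp: single_def)
    moreover have "sum_map ?u = single J N (p i) \<zero>\<^bsub>N (p i)\<^esub>"
      using sum_map_single[OF i module_zero_closed[OF M_module[OF i]]] \<phi>_zero[OF i] by simp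
    ultimately show ?case by auto
  next
    case (insert s S)
    then obtain u where u: "u \<in> carrier (dirsum I M)" "u i = \<zero>\<^bsub>M i\<^esub>"
      "sum_map u = single J N (p i) (finsum (N (p i)) (\<lambda>s. \<phi> (\<alpha> s) (g s)) S)" by blast
    have s: "\<alpha> s \<in> I" "\<alpha> s \<noteq> i" "p (\<alpha> s) = p i" "g s \<in> carrier (M (\<alpha> s))" using insert.prems by auto
    let ?t = "single I M (\<alpha> s) (g s)"
    have t: "?t \<in> carrier (dirsum I M)" using single_closed s by blast
    have cl: "\<phi> (\<alpha> r) (g r) \<in> carrier (N (p i))" if "r \<in> insert s S" for r
      using \<phi>_closed insert.prems[OF that] by metis
    have sum_cl: "finsum (N (p i)) (\<lambda>s. \<phi> (\<alpha> s) (g s)) S \<in> carrier (N (p i))"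
      using cl by (intro N.finsum_closed) auto
    interpret Mi: module k "M i" using M_module i .
    have "(?t \<oplus>\<^bsub>dirsum I M\<^esub> u) i = \<zero>\<^bsub>M i\<^esub>"
      using i s u by (auto simp: dirsum_def single_def)
    moreover have "sum_map (?t \<oplus>\<^bsub>dirsum I M\<^esub> u) =
        single J N (p i) (finsum (N (p i)) (\<lambda>s. \<phi> (\<alpha> s) (g s)) (insert s S))"
    proof -
      have "sum_map (?t \<oplus>\<^bsub>dirsum I M\<^esub> u) = sum_map ?t \<oplus>\<^bsub>dirsum J N\<^esub> sum_map u"
        using klinearD(2)[OF lin t u(1)] .
      also have "\<dots> = single J N (p i) (\<phi> (\<alpha> s) (g s) \<oplus>\<^bsub>N (p i)\<^esub> finsum (N (p i)) (\<lambda>s. \<phi> (\<alpha> s) (g s)) S)"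
        using u(3) sum_map_single[OF s(1,4)] s(3) single_target_add[OF p_closed[OF i]] cl sum_cl by simp
      also have "\<phi> (\<alpha> s) (g s) \<oplus>\<^bsub>N (p i)\<^esub> finsum (N (p i)) (\<lambda>s. \<phi> (\<alpha> s) (g s)) S =
          finsum (N (p i)) (\<lambda>s. \<phi> (\<alpha> s) (g s)) (insert s S)"
        using insert.hyps cl by (subst N.finsum_insert) auto
      finally show ?thesis .
    qed
    ultimately show ?case using dirsum_add_closed[OF t u(1)] by blast
  qed
  then obtain u where u: "u \<in> carrier (dirsum I M)" "u i = \<zero>\<^bsub>M i\<^esub>" "sum_map u = single J N (p i) (\<phi> i m)"
    using eq by auto
  have "u = single I M i m"
    using inj_onD[OF bij_betw_imp_inj_on[OF bij]] u(1,3) single_closed[OF i m] sum_map_single[OF i m] by auto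
  then show ?thesis using u(2) i by (simp add: single_def)
qed

lemma sum_map_lift:
  assumes iso: "module_iso k (dirsum I M) (dirsum J N) sum_map"
    and c: "c \<in> J" and n: "n \<in> carrier (N c)"
  obtains S u where "finite S" "\<And>i. i \<in> S \<Longrightarrow> i \<in> I \<and> p i = c \<and> u i \<in> carrier (M i)"
    "n = finsum (N c) (\<lambda>i. \<phi> i (u i)) S"
proof -
  have "single J N c n \<in> sum_map ` carrier (dirsum I M)"
    using iso single_target_closed[OF c n] by (auto simp: module_iso_def bij_betw_def)
  then obtain u where u: "u \<in> carrier (dirsum I M)" "single J N c n = sum_map u" by blast
  let ?S = "{i \<in> I. p i = c \<and> u i \<noteq> \<zero>\<^bsub>M i\<^esub>}"
  have "n = finsum (N c) (\<lambda>i. \<phi> i (u i)) ?S"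
    using fun_cong[OF u(2), of c] c by (simp add: single_def sum_map_def)
  moreover have "finite ?S"
    using u(1) by (auto simp: dirsum_def elim: finite_subset[rotated])
  moreover have "\<And>i. i \<in> ?S \<Longrightarrow> i \<in> I \<and> p i = c \<and> u i \<in> carrier (M i)"
    using u(1) by (auto simp: dirsum_def)
  ultimately show thesis using that by blast
qed

text \<open>
  When over every \<open>c\<close> only the summand at \<open>s c\<close> is non-zero, the map between the direct sums is,
  up to the relabelling \<open>s\<close>, the direct sum of the isomorphisms \<open>\<phi> (s c)\<close>.
\<close>

lemma sum_map_iso_if_concentrated:
  assumes s: "\<And>c. c \<in> J \<Longrightarrow> s c \<in> I \<and> p (s c) = c"
    and bij: "\<And>c. c \<in> J \<Longrightarrow> bij_betw (\<phi> (s c)) (carrier (M (s c))) (carrier (N c))"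
    and zero: "\<And>i. i \<in> I \<Longrightarrow> i \<noteq> s (p i) \<Longrightarrow> carrier (M i) = {\<zero>\<^bsub>M i\<^esub>}"
  shows "module_iso k (dirsum I M) (dirsum J N) sum_map"
proof -
  \<comment> \<open>No sum is left: the only index that can occur in the support over \<open>c\<close> is \<open>s c\<close>.\<close>
  have ev: "sum_map u c = \<phi> (s c) (u (s c))" if u: "u \<in> carrier (dirsum I M)" and c: "c \<in> J" for u c
  proof -
    interpret N: module k "N c" using N_module c .
    have sc: "s c \<in> I" "p (s c) = c" "u (s c) \<in> carrier (M (s c))"
      using s[OF c] u by (auto simp: dirsum_def)
    have sub: "i = s c" if "i \<in> I" "p i = c" "u i \<noteq> \<zero>\<^bsub>M i\<^esub>" for i
      using zero[OF that(1)] that u by (auto simp: dirsum_def Pi_iff PiE_iff)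
    let ?S = "{i \<in> I. p i = c \<and> u i \<noteq> \<zero>\<^bsub>M i\<^esub>}"
    show ?thesis
    proof (cases "u (s c) = \<zero>\<^bsub>M (s c)\<^esub>")
      case True
      have S: "?S = {}"
      proof (rule equals0I)
        fix i assume i: "i \<in> ?S"
        then have "i = s c" using sub[of i] by simp
        then show False using i True by simp
      qed
      show ?thesis using True c sc \<phi>_zero[OF sc(1)] by (simp only: sum_map_def restrict_apply S) simp
    next
      case False
      have S: "?S = {s c}"
      proof (intro equalityI subsetI)
        fix i assume "i \<in> ?S"
        then show "i \<in> {s c}" using sub[of i] by simp
      qed (use False sc in simp)
      show ?thesis
        using c \<phi>_closed[OF sc(1,3)] sc(2) finsum_one[OF N_module[OF c]]
        by (simp only: sum_map_def restrict_apply S) simp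
    qed
  qed
  have cl: "sum_map u \<in> carrier (dirsum J N)" if u: "u \<in> carrier (dirsum I M)" for u
  proof -
    have "{c \<in> J. sum_map u c \<noteq> \<zero>\<^bsub>N c\<^esub>} \<subseteq> p ` {i \<in> I. u i \<noteq> \<zero>\<^bsub>M i\<^esub>}"
    proof
      fix c assume c: "c \<in> {c \<in> J. sum_map u c \<noteq> \<zero>\<^bsub>N c\<^esub>}"
      then have "s c \<in> I" "p (s c) = c" "u (s c) \<noteq> \<zero>\<^bsub>M (s c)\<^esub>"
        using ev[OF u, of c] s[of c] \<phi>_zero[of "s c"] by auto
      then show "c \<in> p ` {i \<in> I. u i \<noteq> \<zero>\<^bsub>M i\<^esub>}" by (intro image_eqI[of _ _ "s c"]) auto
    qed
    moreover have "finite {i \<in> I. u i \<noteq> \<zero>\<^bsub>M i\<^esub>}" using u by (simp add: dirsum_def)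
    ultimately have "finite {c \<in> J. sum_map u c \<noteq> \<zero>\<^bsub>N c\<^esub>}"
      by (meson finite_imageI finite_subset)
    moreover have "sum_map u c \<in> carrier (N c)" if "c \<in> J" for c
      using ev[OF u that] s[OF that] \<phi>_closed[of "s c" "u (s c)"] u by (auto simp: dirsum_def PiE_iff)
    moreover have "sum_map u \<in> extensional J" by (simp add: sum_map_def)
    ultimately show ?thesis by (simp add: dirsum_def PiE_iff)
  qed
  have u_cl: "u i \<in> carrier (M i)" if "u \<in> carrier (dirsum I M)" "i \<in> I" for u i
    using that by (auto simp: dirsum_def)
  have smult_cl: "(a \<odot>\<^bsub>dirsum I M\<^esub> u) \<in> carrier (dirsum I M)"
    if a: "a \<in> carrier k" and u: "u \<in> carrier (dirsum I M)" for a u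
  proof -
    have *: "a \<odot>\<^bsub>M i\<^esub> u i \<in> carrier (M i)" "a \<odot>\<^bsub>M i\<^esub> \<zero>\<^bsub>M i\<^esub> = \<zero>\<^bsub>M i\<^esub>" if "i \<in> I" for i
      using module.smult_closed[OF M_module[OF that] a u_cl[OF u that]]
        module.smult_r_null[OF M_module[OF that] a] by auto
    have "finite {i \<in> I. (\<lambda>i\<in>I. a \<odot>\<^bsub>M i\<^esub> u i) i \<noteq> \<zero>\<^bsub>M i\<^esub>}"
      using u by (auto simp: dirsum_def * elim!: finite_subset[rotated])
    then show ?thesis using * by (auto simp: dirsum_def)
  qed
  have ext: "sum_map u = v"
    if "v \<in> extensional J" "\<And>c. c \<in> J \<Longrightarrow> sum_map u c = v c" for u v
    by (rule extensionalityI[of _ J]) (use that in \<open>auto simp: sum_map_def\<close>)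
  have "klinear k (dirsum I M) (dirsum J N) sum_map"
  proof (rule klinearI)
    fix u v assume uv: "u \<in> carrier (dirsum I M)" "v \<in> carrier (dirsum I M)"
    show "sum_map (u \<oplus>\<^bsub>dirsum I M\<^esub> v) = sum_map u \<oplus>\<^bsub>dirsum J N\<^esub> sum_map v"
    proof (rule ext)
      fix c assume c: "c \<in> J"
      have "sum_map (u \<oplus>\<^bsub>dirsum I M\<^esub> v) c = \<phi> (s c) (u (s c) \<oplus>\<^bsub>M (s c)\<^esub> v (s c))"
        using ev[OF dirsum_add_closed[OF uv] c] s[OF c] by (simp add: dirsum_def)
      then show "sum_map (u \<oplus>\<^bsub>dirsum I M\<^esub> v) c = (sum_map u \<oplus>\<^bsub>dirsum J N\<^esub> sum_map v) c"
        using ev[OF uv(1) c] ev[OF uv(2) c] c s[OF c] klinearD(2)[OF \<phi>_linear, of "s c" "u (s c)" "v (s c)"]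
          u_cl uv by (simp add: dirsum_def)
    qed (simp add: dirsum_def)
  next
    fix a u assume a: "a \<in> carrier k" and u: "u \<in> carrier (dirsum I M)"
    show "sum_map (a \<odot>\<^bsub>dirsum I M\<^esub> u) = a \<odot>\<^bsub>dirsum J N\<^esub> sum_map u"
    proof (rule ext)
      fix c assume c: "c \<in> J"
      have "sum_map (a \<odot>\<^bsub>dirsum I M\<^esub> u) c = \<phi> (s c) (a \<odot>\<^bsub>M (s c)\<^esub> u (s c))"
        using ev[OF smult_cl[OF a u] c] s[OF c] by (simp add: dirsum_def)
      then show "sum_map (a \<odot>\<^bsub>dirsum I M\<^esub> u) c = (a \<odot>\<^bsub>dirsum J N\<^esub> sum_map u) c"
        using ev[OF u c] c s[OF c] klinearD(3)[OF \<phi>_linear, of "s c" a "u (s c)"] a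
          u_cl u by (simp add: dirsum_def)
    qed (simp add: dirsum_def)
  qed (rule cl)
  moreover have "inj_on sum_map (carrier (dirsum I M))"
  proof (rule inj_onI)
    fix u v assume uv: "u \<in> carrier (dirsum I M)" "v \<in> carrier (dirsum I M)" and eq: "sum_map u = sum_map v"
    show "u = v"
    proof (rule extensionalityI[of _ I])
      fix i assume i: "i \<in> I"
      show "u i = v i"
      proof (cases "i = s (p i)")
        case True
        have c: "p i \<in> J" using p_closed i .
        have "\<phi> i (u i) = \<phi> i (v i)" using ev[OF uv(1) c] ev[OF uv(2) c] eq True by simp
        then show ?thesis
          using inj_onD[OF bij_betw_imp_inj_on[OF bij[OF c]]] u_cl[OF uv(1) i] u_cl[OF uv(2) i] True
          by metis
      next
        case False
        then show ?thesis using zero[OF i False] u_cl[OF uv(1) i] u_cl[OF uv(2) i] by simp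
      qed
    qed (use uv in \<open>auto simp: dirsum_def PiE_iff\<close>)
  qed
  moreover have "v \<in> sum_map ` carrier (dirsum I M)" if v: "v \<in> carrier (dirsum J N)" for v
  proof -
    define r where "r c = inv_into (carrier (M (s c))) (\<phi> (s c))" for c
    have vc: "v c \<in> carrier (N c)" if "c \<in> J" for c using v that by (auto simp: dirsum_def)
    have r: "r c n \<in> carrier (M (s c))" "\<phi> (s c) (r c n) = n" if "c \<in> J" "n \<in> carrier (N c)" for c n
      using bij[OF that(1)] that(2) unfolding r_def bij_betw_def
      by (auto intro: inv_into_into f_inv_into_f)
    have r0: "r c \<zero>\<^bsub>N c\<^esub> = \<zero>\<^bsub>M (s c)\<^esub>" if "c \<in> J" for c
      using inv_into_f_f[OF bij_betw_imp_inj_on[OF bij[OF that]] module_zero_closed[OF M_module]]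
        \<phi>_zero[of "s c"] s[OF that] unfolding r_def by simp
    define u where "u = (\<lambda>i\<in>I. if i = s (p i) then r (p i) (v (p i)) else \<zero>\<^bsub>M i\<^esub>)"
    have "finite (s ` {c \<in> J. v c \<noteq> \<zero>\<^bsub>N c\<^esub>})" using v by (auto simp: dirsum_def)
    then have "finite {i \<in> I. u i \<noteq> \<zero>\<^bsub>M i\<^esub>}"
    proof (rule finite_subset[rotated], safe)
      fix i assume i: "i \<in> I" "u i \<noteq> \<zero>\<^bsub>M i\<^esub>"
      then have "i = s (p i)" "v (p i) \<noteq> \<zero>\<^bsub>N (p i)\<^esub>"
        using r0[OF p_closed[OF i(1)]] by (auto simp: u_def split: if_splits)
      then show "i \<in> s ` {c \<in> J. v c \<noteq> \<zero>\<^bsub>N c\<^esub>}" using p_closed[OF i(1)] by blast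
    qed
    moreover have "u i \<in> carrier (M i)" if "i \<in> I" for i
      using that r(1)[OF p_closed[OF that] vc[OF p_closed[OF that]]] module_zero_closed[OF M_module[OF that]]
      by (auto simp: u_def)
    ultimately have u: "u \<in> carrier (dirsum I M)" by (auto simp: dirsum_def u_def)
    have "sum_map u = v"
    proof (rule ext)
      fix c assume c: "c \<in> J"
      show "sum_map u c = v c"
        using ev[OF u c] s[OF c] r(2)[OF c vc[OF c]] by (simp add: u_def)
    qed (use v in \<open>auto simp: dirsum_def PiE_iff\<close>)
    then show ?thesis using u by blast
  qed
  ultimately show ?thesis using cl unfolding module_iso_def bij_betw_def by blast
qed

end

section \<open>Functors and isomorphisms of k-categories\<close>

lemma k_functorI:
  assumes "k_category k C" "k_category k D"
    and "\<And>x. x \<in> obj C \<Longrightarrow> fobj F x \<in> obj D"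
    and "\<And>x y. \<lbrakk>x \<in> obj C; y \<in> obj C\<rbrakk>
      \<Longrightarrow> klinear k (mor C x y) (mor D (fobj F x) (fobj F y)) (fmor F x y)"
    and "\<And>x y z f g. \<lbrakk>x \<in> obj C; y \<in> obj C; z \<in> obj C; f \<in> carrier (mor C x y); g \<in> carrier (mor C y z)\<rbrakk>
      \<Longrightarrow> fmor F x z (cmp C x y z g f) =
          cmp D (fobj F x) (fobj F y) (fobj F z) (fmor F y z g) (fmor F x y f)"
    and "\<And>x. x \<in> obj C \<Longrightarrow> fmor F x x (idn C x) = idn D (fobj F x)"
  shows "k_functor k C D F"
  by (intro k_functor.intro k_functor_axioms.intro assms)

lemma (in k_category) cmp_closed:
  assumes "x \<in> obj B" "y \<in> obj B" "z \<in> obj B" "f \<in> carrier (mor B x y)" "g \<in> carrier (mor B y z)"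
  shows "cmp B x y z g f \<in> carrier (mor B x z)"
  using klinearD(1)[OF cmp_linear_left[OF assms(1-4)] assms(5)] .

lemma (in k_functor) fmor_closed:
  assumes "x \<in> obj C" "y \<in> obj C" "f \<in> carrier (mor C x y)"
  shows "fmor F x y f \<in> carrier (mor D (fobj F x) (fobj F y))"
  using klinearD(1)[OF fmor_linear[OF assms(1,2)] assms(3)] .

lemma k_functor_comp:
  assumes "k_functor k C D F" "k_functor k D E G"
  shows "k_functor k C E (comp_kfun G F)"
proof -
  interpret F: k_functor k C D F by fact
  interpret G: k_functor k D E G by fact
  show ?thesis
    by (rule k_functorI)
      (auto simp: comp_kfun_def F.fobj_closed G.fobj_closed F.fmor_closed F.fmor_cmp G.fmor_cmp
        F.fmor_idn G.fmor_idn F.C.k_category_axioms G.D.k_category_axioms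
        intro: klinear_comp[OF F.fmor_linear G.fmor_linear])
qed

lemma k_functor_id:
  assumes "k_category k C"
  shows "k_functor k C C id_kfun"
  by (rule k_functorI) (auto simp: assms id_kfun_def klinear_def)

lemma kcat_iso_id:
  assumes "k_category k C"
  shows "kcat_iso k C C id_kfun"
  using k_functor_id[OF assms] by (auto simp: kcat_iso_def kfun_eq_def comp_kfun_def id_kfun_def)

text \<open>
  The inverse maps of a fully faithful functor that is bijective on objects satisfy the functor
  laws, because these can be checked after applying the functor itself.
\<close>

lemma kcat_isoI:
  assumes H: "k_functor k C D H"
    and obj: "bij_betw (fobj H) (obj C) (obj D)"
    and mor: "\<And>x y. \<lbrakk>x \<in> obj C; y \<in> obj C\<rbrakk> \<Longrightarrow>
      bij_betw (fmor H x y) (carrier (mor C x y)) (carrier (mor D (fobj H x) (fobj H y)))"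
  shows "kcat_iso k C D H"
proof -
  interpret H: k_functor k C D H by fact
  define h where "h = inv_into (obj C) (fobj H)"
  define H' where "H' = \<lparr> fobj = h,
    fmor = (\<lambda>u v. inv_into (carrier (mor C (h u) (h v))) (fmor H (h u) (h v))) \<rparr>"
  have h: "h u \<in> obj C" "fobj H (h u) = u" if "u \<in> obj D" for u
    using obj that unfolding h_def bij_betw_def by (auto intro: inv_into_into f_inv_into_f)
  have hH: "h (fobj H x) = x" if "x \<in> obj C" for x
    using obj that unfolding h_def bij_betw_def by auto
  have inj: "f = f'" if "x \<in> obj C" "y \<in> obj C" "f \<in> carrier (mor C x y)" "f' \<in> carrier (mor C x y)"
    "fmor H x y f = fmor H x y f'" for x y f f'
    using inj_onD[OF bij_betw_imp_inj_on[OF mor]] that by blast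
  have g: "fmor H' u v n \<in> carrier (mor C (h u) (h v))" "fmor H (h u) (h v) (fmor H' u v n) = n"
    if "u \<in> obj D" "v \<in> obj D" "n \<in> carrier (mor D u v)" for u v n
  proof -
    have "n \<in> fmor H (h u) (h v) ` carrier (mor C (h u) (h v))"
      using bij_betw_imp_surj_on[OF mor[of "h u" "h v"]] h that by simp
    then show "fmor H' u v n \<in> carrier (mor C (h u) (h v))" "fmor H (h u) (h v) (fmor H' u v n) = n"
      unfolding H'_def by (auto intro: inv_into_into f_inv_into_f)
  qed
  have H': "fobj H' = h" by (simp add: H'_def)
  have "k_functor k D C H'"
  proof (rule k_functorI)
    fix u v assume uv: "u \<in> obj D" "v \<in> obj D"
    interpret M: module k "mor C (h u) (h v)" using H.C.mor_module h uv by blast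
    interpret N: module k "mor D u v" using H.D.mor_module uv by blast
    have lin: "klinear k (mor C (h u) (h v)) (mor D u v) (fmor H (h u) (h v))"
      using H.fmor_linear[of "h u" "h v"] h uv by simp
    show "klinear k (mor D u v) (mor C (fobj H' u) (fobj H' v)) (fmor H' u v)"
      unfolding H'
    proof (rule klinearI)
      fix m n assume mn: "m \<in> carrier (mor D u v)" "n \<in> carrier (mor D u v)"
      show "fmor H' u v (m \<oplus>\<^bsub>mor D u v\<^esub> n) = fmor H' u v m \<oplus>\<^bsub>mor C (h u) (h v)\<^esub> fmor H' u v n"
        by (rule inj[OF h(1)[OF uv(1)] h(1)[OF uv(2)]]) (simp_all add: g uv mn klinearD(2)[OF lin])
    next
      fix a n assume a: "a \<in> carrier k" and n: "n \<in> carrier (mor D u v)"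
      show "fmor H' u v (a \<odot>\<^bsub>mor D u v\<^esub> n) = a \<odot>\<^bsub>mor C (h u) (h v)\<^esub> fmor H' u v n"
        by (rule inj[OF h(1)[OF uv(1)] h(1)[OF uv(2)]]) (simp_all add: g uv a n klinearD(3)[OF lin])
    qed (use g uv in blast)
  next
    fix u v w m n
    assume *: "u \<in> obj D" "v \<in> obj D" "w \<in> obj D" "m \<in> carrier (mor D u v)" "n \<in> carrier (mor D v w)"
    show "fmor H' u w (cmp D u v w n m) =
      cmp C (fobj H' u) (fobj H' v) (fobj H' w) (fmor H' v w n) (fmor H' u v m)"
      unfolding H'
      by (rule inj[OF h(1)[OF *(1)] h(1)[OF *(3)]])
        (use * in \<open>simp_all add: g h H.C.cmp_closed H.D.cmp_closed H.fmor_cmp\<close>)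
  next
    fix u assume u: "u \<in> obj D"
    show "fmor H' u u (idn D u) = idn C (fobj H' u)"
      unfolding H'
      by (rule inj[OF h(1)[OF u] h(1)[OF u]])
        (use u in \<open>simp_all add: g h H.C.idn_closed H.D.idn_closed H.fmor_idn\<close>)
  qed (use h H.C.k_category_axioms H.D.k_category_axioms in \<open>simp_all add: H'\<close>)
  moreover have "kfun_eq C (comp_kfun H' H) id_kfun"
  proof -
    have "fmor H' (fobj H x) (fobj H y) (fmor H x y f) = f"
      if "x \<in> obj C" "y \<in> obj C" "f \<in> carrier (mor C x y)" for x y f
      using that inj[of x y _ f] g[of "fobj H x" "fobj H y" "fmor H x y f"] hH H.fobj_closed H.fmor_closed
      by simp
    then show ?thesis using hH by (simp add: kfun_eq_def comp_kfun_def id_kfun_def H')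
  qed
  moreover have "kfun_eq D (comp_kfun H H') id_kfun"
    using h g by (simp add: kfun_eq_def comp_kfun_def id_kfun_def H')
  ultimately show ?thesis using H unfolding kcat_iso_def by blast
qed

section \<open>Coverings and lifts of morphisms\<close>

text \<open>
  A star has an outgoing and an incoming half, and a walk may traverse a morphism in either
  direction.  The flag selects the direction: \<open>dmor C True x y\<close> are the morphisms from \<open>x\<close> to
  \<open>y\<close>, and \<open>dmor C False x y\<close> those from \<open>y\<close> to \<open>x\<close>.  With it, the outgoing and the incoming
  version of each lifting argument are proved as one statement.
\<close>

definition dmor :: "('k, 'o, 'm) kcat \<Rightarrow> bool \<Rightarrow> 'o \<Rightarrow> 'o \<Rightarrow> ('k, 'm) module"
  where "dmor C d x y = (if d then mor C x y else mor C y x)"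

definition dfmor :: "('o, 'm, 'p, 'n) kfun \<Rightarrow> bool \<Rightarrow> 'o \<Rightarrow> 'o \<Rightarrow> 'm \<Rightarrow> 'n"
  where "dfmor F d x y = (if d then fmor F x y else fmor F y x)"

lemma (in k_category) dmor_module: "x \<in> obj B \<Longrightarrow> y \<in> obj B \<Longrightarrow> module k (dmor B d x y)"
  by (simp add: dmor_def mor_module)

context k_functor
begin

lemma dfmor_linear:
  assumes "x \<in> obj C" "y \<in> obj C"
  shows "klinear k (dmor C d x y) (dmor D d (fobj F x) (fobj F y)) (dfmor F d x y)"
  using assms by (simp add: dmor_def dfmor_def fmor_linear)

lemma dfmor_closed:
  assumes "x \<in> obj C" "y \<in> obj C" "f \<in> carrier (dmor C d x y)"
  shows "dfmor F d x y f \<in> carrier (dmor D d (fobj F x) (fobj F y))"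
  using klinearD(1)[OF dfmor_linear] assms by blast

lemma dfmor_zero:
  assumes "x \<in> obj C" "y \<in> obj C"
  shows "dfmor F d x y \<zero>\<^bsub>dmor C d x y\<^esub> = \<zero>\<^bsub>dmor D d (fobj F x) (fobj F y)\<^esub>"
  by (rule klinear_zero[OF C.dmor_module D.dmor_module dfmor_linear]) (simp_all add: assms fobj_closed)

lemma star_families:
  assumes "x \<in> obj C"
  shows "module_families k (obj C) (dmor C d x) (obj D) (dmor D d (fobj F x)) (fobj F) (dfmor F d x)"
  by (rule module_families.intro) (use assms in \<open>simp_all add: C.dmor_module D.dmor_module dfmor_linear fobj_closed\<close>)

abbreviation star_sum :: "bool \<Rightarrow> 'o \<Rightarrow> ('o \<Rightarrow> 'm) \<Rightarrow> 'p \<Rightarrow> 'n"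
  where "star_sum d x \<equiv> module_families.sum_map (obj C) (dmor C d x) (obj D)
    (dmor D d (fobj F x)) (fobj F) (dfmor F d x)"

text \<open>
  The covering condition at \<open>x\<close> splits into independent conditions on the two halves of the star,
  each of the kind studied above.
\<close>

lemma star_map_iso_iff:
  assumes x: "x \<in> obj C"
  shows "module_iso k (star C x) (star D (fobj F x)) (star_map C D F x) \<longleftrightarrow>
    (\<forall>d. module_iso k (dirsum (obj C) (dmor C d x)) (dirsum (obj D) (dmor D d (fobj F x))) (star_sum d x))"
proof -
  have ne: "carrier (dirsum (obj C) (dmor C d x)) \<noteq> {}" for d
    using module_families.single_closed[OF star_families[OF x] x
        module_zero_closed[OF C.dmor_module[OF x x]]] by blast
  have s: "star_map C D F x = (\<lambda>(u, v). (star_sum True x u, star_sum False x v))"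
    by (simp add: star_map_def module_families.sum_map_def[OF star_families[OF x]] fibre_def
        dmor_def dfmor_def conj_assoc)
  have "(\<lambda>y. mor C x y) = dmor C True x" "(\<lambda>y. mor C y x) = dmor C False x"
    "(\<lambda>c. mor D (fobj F x) c) = dmor D True (fobj F x)"
    "(\<lambda>c. mor D c (fobj F x)) = dmor D False (fobj F x)"
    by (auto simp: dmor_def)
  then show ?thesis
    unfolding star_def s using module_iso_dirsum2_iff[OF ne[of True] ne[of False]] by (simp add: all_bool_eq)
qed

text \<open>
  In general a morphism of the base lifts to a sum of morphisms with various ends.  A functor is in
  particular a covering if every lift has a single end \<open>y\<close>, depending only on the starting
  object \<open>x\<close> and on the end \<open>c\<close> of the morphism that is lifted.
\<close>

lemma covering_if_concentrated:
  assumes surj: "fobj F ` obj C = obj D"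
    and conc: "\<And>x c. \<lbrakk>x \<in> obj C; c \<in> obj D\<rbrakk> \<Longrightarrow> \<exists>y\<in>obj C. fobj F y = c \<and>
      (\<forall>d. bij_betw (dfmor F d x y) (carrier (dmor C d x y)) (carrier (dmor D d (fobj F x) c)) \<and>
           (\<forall>z\<in>obj C. fobj F z = c \<and> z \<noteq> y \<longrightarrow> carrier (dmor C d x z) = {\<zero>\<^bsub>dmor C d x z\<^esub>}))"
  shows "k_covering k C D F"
proof -
  have "module_iso k (dirsum (obj C) (dmor C d x)) (dirsum (obj D) (dmor D d (fobj F x))) (star_sum d x)"
    if x: "x \<in> obj C" for d x
  proof -
    have "\<forall>c\<in>obj D. \<exists>y. y \<in> obj C \<and> fobj F y = c \<and>
      bij_betw (dfmor F d x y) (carrier (dmor C d x y)) (carrier (dmor D d (fobj F x) c)) \<and>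
      (\<forall>z\<in>obj C. fobj F z = c \<and> z \<noteq> y \<longrightarrow> carrier (dmor C d x z) = {\<zero>\<^bsub>dmor C d x z\<^esub>})"
      using conc[OF x] by blast
    from bchoice[OF this] obtain s where s: "\<forall>c\<in>obj D. s c \<in> obj C \<and> fobj F (s c) = c \<and>
      bij_betw (dfmor F d x (s c)) (carrier (dmor C d x (s c))) (carrier (dmor D d (fobj F x) c)) \<and>
      (\<forall>z\<in>obj C. fobj F z = c \<and> z \<noteq> s c \<longrightarrow> carrier (dmor C d x z) = {\<zero>\<^bsub>dmor C d x z\<^esub>})"
      by blast
    show ?thesis
      by (rule module_families.sum_map_iso_if_concentrated[OF star_families[OF x], of s])
        (use s fobj_closed in blast)+
  qed
  then have "module_iso k (star C x) (star D (fobj F x)) (star_map C D F x)" if "x \<in> obj C" for x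
    using star_map_iso_iff[OF that] that by blast
  then show ?thesis
    using surj k_functor_axioms by (auto simp: k_covering_def fibre_def)
qed

end

locale kcovering = k_functor k C B F
  for k :: "'k ring"
  and C :: "('k, 'o, 'm) kcat"
  and B :: "('k, 'p, 'n) kcat"
  and F :: "('o, 'm, 'p, 'n) kfun" +
  assumes covering: "k_covering k C B F"
begin

lemma star_sum_iso:
  assumes "x \<in> obj C"
  shows "module_iso k (dirsum (obj C) (dmor C d x)) (dirsum (obj B) (dmor B d (fobj F x))) (star_sum d x)"
  using covering star_map_iso_iff[OF assms] assms fobj_closed[OF assms]
  by (auto simp: k_covering_def fibre_def)

lemma faithful:
  assumes "x \<in> obj C" "y \<in> obj C" "f \<in> carrier (dmor C d x y)" "f' \<in> carrier (dmor C d x y)"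
    and "dfmor F d x y f = dfmor F d x y f'"
  shows "f = f'"
  using module_families.sum_map_faithful[OF star_families star_sum_iso] assms by blast

lemmas lift_separates = module_families.sum_map_separates[OF star_families star_sum_iso]

lemmas lift_exists = module_families.sum_map_lift[OF star_families star_sum_iso]

text \<open>
  A non-zero morphism of the base has at most one homogeneous lift at \<open>x\<close>: two lifts with
  different ends would lie in different summands of the star.
\<close>

lemma lift_target_unique:
  assumes obj: "x \<in> obj C" "y \<in> obj C" "y' \<in> obj C" and y': "fobj F y' = fobj F y" "y' \<noteq> y"
    and f: "f \<in> carrier (dmor C d x y)" "f' \<in> carrier (dmor C d x y')"
    and eq: "dfmor F d x y f = dfmor F d x y' f'"
  shows "f = \<zero>\<^bsub>dmor C d x y\<^esub>"
proof (rule lift_separates[OF obj(1) obj(1,2) f(1), of "{y'}" "\<lambda>s. s" "\<lambda>_. f'"])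
  show "dfmor F d x y f = finsum (dmor B d (fobj F x) (fobj F y)) (\<lambda>s. dfmor F d x s f') {y'}"
    using finsum_one[OF D.dmor_module, of "fobj F x" "fobj F y" "\<lambda>s. dfmor F d x s f'" y' d]
      dfmor_closed[OF obj(1,3) f(2)] y' obj eq fobj_closed by simp
qed (use obj y' f in auto)

end

section \<open>Deck transformations\<close>

text \<open>
  Deck transformations without invertibility.  In a connected covering, uniqueness of lifts
  makes such an endofunctor invertible as soon as another one undoes it at a single object.
\<close>

definition deck_endo ::
  "'k ring \<Rightarrow> ('k, 'o, 'm) kcat \<Rightarrow> ('o, 'm, 'p, 'n) kfun \<Rightarrow> ('o, 'm, 'o, 'm) kfun \<Rightarrow> bool"
  where "deck_endo k C F T \<longleftrightarrow> k_functor k C C T \<and> kfun_eq C (comp_kfun F T) F"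

lemma deck_endo_fobj:
  assumes "deck_endo k C F T" "x \<in> obj C"
  shows "fobj T x \<in> obj C" "fobj F (fobj T x) = fobj F x"
  using assms k_functor.fobj_closed
  by (fastforce simp: deck_endo_def kfun_eq_def comp_kfun_def)+

lemma deck_endo_dfmor:
  assumes "deck_endo k C F T" "x \<in> obj C" "y \<in> obj C" "f \<in> carrier (dmor C d x y)"
  shows "dfmor T d x y f \<in> carrier (dmor C d (fobj T x) (fobj T y))"
    and "dfmor F d (fobj T x) (fobj T y) (dfmor T d x y f) = dfmor F d x y f"
proof -
  show "dfmor T d x y f \<in> carrier (dmor C d (fobj T x) (fobj T y))"
    using k_functor.dfmor_closed[OF _ assms(2-4), of k C T] assms(1) by (simp add: deck_endo_def)
  show "dfmor F d (fobj T x) (fobj T y) (dfmor T d x y f) = dfmor F d x y f"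
    using assms by (cases d) (simp_all add: deck_endo_def kfun_eq_def comp_kfun_def dfmor_def dmor_def)
qed

text \<open>
  The inverse commutes with \<open>F\<close> as well, since \<open>F K = (F H) K = F (H K) = F\<close>.
\<close>

lemma Aut1_inverse:
  assumes "H \<in> Aut1 k C F"
  obtains K where "deck_endo k C F K"
    and "\<And>x. x \<in> obj C \<Longrightarrow> fobj K (fobj H x) = x" "\<And>x. x \<in> obj C \<Longrightarrow> fobj H (fobj K x) = x"
proof -
  obtain K where H: "k_functor k C C H" and K: "k_functor k C C K"
    and HK: "kfun_eq C (comp_kfun K H) id_kfun" "kfun_eq C (comp_kfun H K) id_kfun"
    and FH: "kfun_eq C (comp_kfun F H) F"
    using assms by (auto simp: Aut1_def kcat_iso_def)
  interpret K: k_functor k C C K by fact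
  have *: "fobj H (fobj K x) = x" if "x \<in> obj C" for x
    using HK that by (simp add: kfun_eq_def comp_kfun_def id_kfun_def)
  have "kfun_eq C (comp_kfun F K) F"
    unfolding kfun_eq_def comp_kfun_def
  proof (intro conjI ballI)
    fix x assume x: "x \<in> obj C"
    have "fobj F (fobj K x) = fobj F (fobj H (fobj K x))"
      using FH K.fobj_closed[OF x] by (simp add: kfun_eq_def comp_kfun_def)
    then show "fobj \<lparr>fobj = \<lambda>x. fobj F (fobj K x),
        fmor = \<lambda>x y f. fmor F (fobj K x) (fobj K y) (fmor K x y f)\<rparr> x = fobj F x"
      using *[OF x] by simp
  next
    fix x y f assume xyf: "x \<in> obj C" "y \<in> obj C" "f \<in> carrier (mor C x y)"
    have "fmor F (fobj K x) (fobj K y) (fmor K x y f) =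
        fmor F (fobj H (fobj K x)) (fobj H (fobj K y)) (fmor H (fobj K x) (fobj K y) (fmor K x y f))"
      using FH K.fobj_closed K.fmor_closed xyf by (simp add: kfun_eq_def comp_kfun_def)
    also have "fmor H (fobj K x) (fobj K y) (fmor K x y f) = f"
      using HK(2) xyf by (simp add: kfun_eq_def comp_kfun_def id_kfun_def)
    finally show "fmor \<lparr>fobj = \<lambda>x. fobj F (fobj K x),
        fmor = \<lambda>x y f. fmor F (fobj K x) (fobj K y) (fmor K x y f)\<rparr> x y f = fmor F x y f"
      using * xyf by simp
  qed
  then show thesis
    using that[of K] K * HK(1) by (simp add: deck_endo_def kfun_eq_def comp_kfun_def id_kfun_def)
qed

lemma Aut1_deck_endo: "H \<in> Aut1 k C F \<Longrightarrow> deck_endo k C F H"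
  by (simp add: Aut1_def deck_endo_def kcat_iso_def)

lemma deck_endo_comp:
  assumes "deck_endo k C F T" "deck_endo k C F S"
  shows "deck_endo k C F (comp_kfun T S)"
proof -
  interpret S: k_functor k C C S using assms(2) by (simp add: deck_endo_def)
  show ?thesis
    using assms k_functor_comp[of k C C S C T] S.fobj_closed S.fmor_closed
    by (simp add: deck_endo_def kfun_eq_def comp_kfun_def)
qed

lemma nonzero_walk_invariant:
  assumes walk: "nonzero_walk C x y" and "P x"
    and step: "\<And>d y z f. \<lbrakk>y \<in> obj C; z \<in> obj C; f \<in> carrier (dmor C d y z);
      f \<noteq> \<zero>\<^bsub>dmor C d y z\<^esub>; P y\<rbrakk> \<Longrightarrow> P z"
  shows "P y"
proof -
  have "y \<in> obj C \<and> (P x \<longrightarrow> P y)"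
    using walk
  proof induction
    case (forward x y z f)
    then show ?case using step[of y z f True] by (auto simp: dmor_def)
  next
    case (backward x y z f)
    then show ?case using step[of y z f False] by (auto simp: dmor_def)
  qed auto
  then show ?thesis using \<open>P x\<close> by blast
qed

context kcovering
begin

text \<open>
  Uniqueness of lifts.  For a non-zero \<open>f\<close> starting where \<open>T\<close> and \<open>S\<close> agree, \<open>T f\<close> and \<open>S f\<close> are
  homogeneous lifts of the same non-zero morphism \<open>F f\<close> at the same object, so they have the same
  end.  Agreement therefore travels along non-zero walks, hence to all objects, and then
  faithfulness of \<open>F\<close> gives agreement on morphisms.
\<close>

lemma deck_endo_unique:
  assumes conn: "kcat_connected C" and T: "deck_endo k C F T" and S: "deck_endo k C F S"
    and x: "x \<in> obj C" and eq: "fobj T x = fobj S x"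
  shows "kfun_eq C T S"
proof -
  have o: "fobj T y = fobj S y" if "y \<in> obj C" for y
  proof -
    have "nonzero_walk C x y" using conn x that by (simp add: kcat_connected_def)
    then show ?thesis
    proof (rule nonzero_walk_invariant[where P = "\<lambda>y. fobj T y = fobj S y", OF _ eq])
      fix d y z f
      assume *: "y \<in> obj C" "z \<in> obj C" "f \<in> carrier (dmor C d y z)" "f \<noteq> \<zero>\<^bsub>dmor C d y z\<^esub>"
        "fobj T y = fobj S y"
      note Tf = deck_endo_dfmor[OF T *(1-3)] and Sf = deck_endo_dfmor[OF S *(1-3)]
      note To = deck_endo_fobj[OF T] and So = deck_endo_fobj[OF S]
      show "fobj T z = fobj S z"
      proof (rule ccontr)
        assume ne: "fobj T z \<noteq> fobj S z"
        have "dfmor T d y z f = \<zero>\<^bsub>dmor C d (fobj T y) (fobj T z)\<^esub>"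
          by (rule lift_target_unique[of _ _ "fobj S z" _ _ "dfmor S d y z f"])
            (use * ne Tf Sf To So in simp_all)
        then have "dfmor F d y z f = dfmor F d y z \<zero>\<^bsub>dmor C d y z\<^esub>"
          using Tf(2) dfmor_zero[OF To(1)[OF *(1)] To(1)[OF *(2)]] dfmor_zero[OF *(1,2)] To(2) *(1,2)
          by simp
        then show False
          using faithful[OF *(1-3) module_zero_closed[OF C.dmor_module[OF *(1,2)]]] *(4) by blast
      qed
    qed
  qed
  have "fmor T x y f = fmor S x y f" if "x \<in> obj C" "y \<in> obj C" "f \<in> carrier (mor C x y)" for x y f
    using faithful[of "fobj T x" "fobj T y" "fmor T x y f" True "fmor S x y f"] that o
      deck_endo_fobj[OF T] deck_endo_dfmor[OF T, of x y f True] deck_endo_dfmor[OF S, of x y f True]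
    by (simp add: dmor_def dfmor_def)
  then show ?thesis using o by (simp add: kfun_eq_def)
qed

lemma deck_endo_id: "deck_endo k C F id_kfun"
  using k_functor_id[OF C.k_category_axioms] by (simp add: deck_endo_def kfun_eq_def comp_kfun_def id_kfun_def)

text \<open>
  Both composites fix an object, so they are the identity by uniqueness of lifts.
\<close>

lemma deck_endo_Aut1:
  assumes conn: "kcat_connected C" and T: "deck_endo k C F T" and S: "deck_endo k C F S"
    and x: "x \<in> obj C" and ST: "fobj S (fobj T x) = x"
  shows "T \<in> Aut1 k C F"
proof -
  have "kfun_eq C (comp_kfun S T) id_kfun"
    by (rule deck_endo_unique[OF conn deck_endo_comp[OF S T] deck_endo_id x])
      (simp add: comp_kfun_def id_kfun_def ST)
  moreover have "kfun_eq C (comp_kfun T S) id_kfun"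
    by (rule deck_endo_unique[OF conn deck_endo_comp[OF T S] deck_endo_id deck_endo_fobj(1)[OF T x]])
      (simp add: comp_kfun_def id_kfun_def ST)
  ultimately show ?thesis
    using S T unfolding Aut1_def kcat_iso_def deck_endo_def by blast
qed

text \<open>
  The orbit of \<open>x\<close> under the deck transformations is contained in the fibre through \<open>x\<close>; the
  predicate says that it is all of it.
\<close>

definition orbit_is_fibre :: "'o \<Rightarrow> bool"
  where "orbit_is_fibre x \<longleftrightarrow> (\<forall>y\<in>fibre C F (fobj F x). \<exists>H\<in>Aut1 k C F. fobj H x = y)"

text \<open>
  Transitivity passes from the fibre of \<open>x\<close> to that of \<open>y\<close> along a non-zero \<open>f\<close> between them.
  Given \<open>y1\<close> over \<open>F y\<close>, lift \<open>F f\<close> at the end \<open>y1\<close> to a sum of morphisms \<open>u z\<close> between various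
  objects \<open>z\<close> over \<open>F x\<close> and \<open>y1\<close>.  As \<open>z\<close> is in the orbit of \<open>x\<close>, some deck transformation \<open>K z\<close>
  moves \<open>z\<close> back to \<open>x\<close>, and the morphisms \<open>K z (u z)\<close>, which now all have the end \<open>x\<close> in common
  with \<open>f\<close>, have images that add up to \<open>F f\<close>.  If none of them ended at \<open>y\<close>, the component \<open>f\<close> would be
  zero.  So some \<open>K z\<close> moves \<open>y1\<close> to \<open>y\<close>.
\<close>

lemma orbit_is_fibre_step:
  assumes x: "x \<in> obj C" and y: "y \<in> obj C" and f: "f \<in> carrier (dmor C d x y)"
    and nonzero: "f \<noteq> \<zero>\<^bsub>dmor C d x y\<^esub>" and orbit: "orbit_is_fibre x"
  shows "orbit_is_fibre y"
  unfolding orbit_is_fibre_def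
proof
  fix y1 assume "y1 \<in> fibre C F (fobj F y)"
  then have y1: "y1 \<in> obj C" "fobj F y1 = fobj F y" by (auto simp: fibre_def)
  \<comment> \<open>Reversing the direction turns the star at \<open>y1\<close> into morphisms that point the same way as \<open>f\<close>.\<close>
  have swap: "dmor B (\<not> d) (fobj F y) (fobj F x) = dmor B d (fobj F x) (fobj F y)"
    "\<And>z. dmor C (\<not> d) y1 z = dmor C d z y1" "\<And>z. dfmor F (\<not> d) y1 z = dfmor F d z y1"
    by (auto simp: dmor_def dfmor_def)
  have n: "dfmor F d x y f \<in> carrier (dmor B (\<not> d) (fobj F y1) (fobj F x))"
    using dfmor_closed[OF x y f] y1 swap by simp
  obtain S u where S: "finite S"
    and u: "\<And>z. z \<in> S \<Longrightarrow> z \<in> obj C \<and> fobj F z = fobj F x \<and> u z \<in> carrier (dmor C d z y1)"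
    and sum: "dfmor F d x y f =
      finsum (dmor B d (fobj F x) (fobj F y)) (\<lambda>z. dfmor F d z y1 (u z)) S"
    using lift_exists[OF y1(1) y1(1) fobj_closed[OF x] n] unfolding y1 swap by blast
  have "\<forall>z\<in>S. \<exists>H K. H \<in> Aut1 k C F \<and> deck_endo k C F K \<and> fobj K z = x \<and> fobj H (fobj K y1) = y1"
  proof
    fix z assume z: "z \<in> S"
    obtain H where H: "H \<in> Aut1 k C F" "fobj H x = z"
      using orbit u[OF z] by (auto simp: orbit_is_fibre_def fibre_def)
    show "\<exists>H K. H \<in> Aut1 k C F \<and> deck_endo k C F K \<and> fobj K z = x \<and> fobj H (fobj K y1) = y1"
      using Aut1_inverse[OF H(1)] H x y1(1) by metis
  qed
  then obtain H K where HK: "\<And>z. z \<in> S \<Longrightarrow> H z \<in> Aut1 k C F \<and> deck_endo k C F (K z) \<and>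
      fobj (K z) z = x \<and> fobj (H z) (fobj (K z) y1) = y1"
    by metis
  have "\<exists>z\<in>S. fobj (K z) y1 = y"
  proof (rule ccontr)
    assume none: "\<not> (\<exists>z\<in>S. fobj (K z) y1 = y)"
    define \<alpha> where "\<alpha> z = fobj (K z) y1" for z
    define g where "g z = dfmor (K z) d z y1 (u z)" for z
    have g: "g z \<in> carrier (dmor C d x (\<alpha> z))" "dfmor F d x (\<alpha> z) (g z) = dfmor F d z y1 (u z)"
      if z: "z \<in> S" for z
      using deck_endo_dfmor[of k C F "K z" z y1 "u z" d] HK[OF z] u[OF z] y1 by (simp_all add: \<alpha>_def g_def)
    have "f = \<zero>\<^bsub>dmor C d x y\<^esub>"
    proof (rule lift_separates[OF x x y f S])
      fix z assume z: "z \<in> S"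
      show "\<alpha> z \<in> obj C \<and> \<alpha> z \<noteq> y \<and> fobj F (\<alpha> z) = fobj F y \<and> g z \<in> carrier (dmor C d x (\<alpha> z))"
        using g(1)[OF z] deck_endo_fobj[of k C F "K z" y1] HK[OF z] y1 none z by (auto simp: \<alpha>_def)
    next
      have cl: "dfmor F d z y1 (u z) \<in> carrier (dmor B d (fobj F x) (fobj F y))" if "z \<in> S" for z
        using dfmor_closed[of z y1 "u z" d] u[OF that] y1 by simp
      interpret N: module k "dmor B d (fobj F x) (fobj F y)"
        using D.dmor_module fobj_closed x y by blast
      show "dfmor F d x y f = finsum (dmor B d (fobj F x) (fobj F y)) (\<lambda>z. dfmor F d x (\<alpha> z) (g z)) S"
        unfolding sum by (rule N.finsum_cong') (use cl g in auto)
    qed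
    then show False using nonzero by blast
  qed
  then show "\<exists>H\<in>Aut1 k C F. fobj H y = y1" using HK by metis
qed

text \<open>
  Being Galois asks for transitivity on one fibre only; connectedness spreads it to all of them.
\<close>

lemma galois_iff_all_orbits_are_fibres:
  assumes conn: "kcat_connected C" and ne: "obj B \<noteq> {}"
  shows "galois_covering k C B F \<longleftrightarrow> (\<forall>x\<in>obj C. orbit_is_fibre x)"
proof
  assume "galois_covering k C B F"
  then obtain b where b: "b \<in> obj B"
    and tr: "\<forall>x\<in>fibre C F b. \<forall>y\<in>fibre C F b. \<exists>H\<in>Aut1 k C F. fobj H x = y"
    by (auto simp: galois_covering_def)
  have "b \<in> fobj F ` obj C" using b covering by (simp add: k_covering_def)
  then obtain x where x: "x \<in> obj C" "fobj F x = b" by blast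
  have orbit: "orbit_is_fibre x" using tr x by (auto simp: orbit_is_fibre_def fibre_def)
  show "\<forall>x\<in>obj C. orbit_is_fibre x"
  proof
    fix y assume "y \<in> obj C"
    then have "nonzero_walk C x y" using conn x(1) by (simp add: kcat_connected_def)
    then show "orbit_is_fibre y"
      by (rule nonzero_walk_invariant[where P = orbit_is_fibre, OF _ orbit]) (rule orbit_is_fibre_step)
  qed
next
  assume "\<forall>x\<in>obj C. orbit_is_fibre x"
  then show "galois_covering k C B F"
    using conn ne covering by (auto simp: galois_covering_def orbit_is_fibre_def fibre_def)
qed

end

section \<open>Fibre products and trivial coverings as k-categories\<close>

text \<open>
  The morphism modules of a fibre product have this form.
\<close>

lemma module_equalizer:
  assumes M: "module k M" and N: "module k N" and P: "module k P"
    and f: "klinear k M P f" and g: "klinear k N P g"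
  shows "module k ((dirsum2 M N) \<lparr> carrier := {(u, v). u \<in> carrier M \<and> v \<in> carrier N \<and> f u = g v} \<rparr>)"
proof -
  interpret M: module k M by fact
  interpret N: module k N by fact
  interpret P: module k P by fact
  note lin = klinearD[OF f] klinearD[OF g]
  have zero: "f \<zero>\<^bsub>M\<^esub> = g \<zero>\<^bsub>N\<^esub>" using klinear_zero[OF M P f] klinear_zero[OF N P g] by simp
  let ?E = "(dirsum2 M N) \<lparr> carrier := {(u, v). u \<in> carrier M \<and> v \<in> carrier N \<and> f u = g v} \<rparr>"
  have "\<exists>w\<in>carrier ?E. w \<oplus>\<^bsub>?E\<^esub> z = \<zero>\<^bsub>?E\<^esub>" if "z \<in> carrier ?E" for z
  proof -
    obtain u v where z: "z = (u, v)" "u \<in> carrier M" "v \<in> carrier N" "f u = g v"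
      using \<open>z \<in> carrier ?E\<close> by auto
    let ?a = "\<ominus>\<^bsub>k\<^esub> \<one>\<^bsub>k\<^esub>"
    have neg: "?a \<odot>\<^bsub>M\<^esub> u \<oplus>\<^bsub>M\<^esub> u = \<zero>\<^bsub>M\<^esub>" "?a \<odot>\<^bsub>N\<^esub> v \<oplus>\<^bsub>N\<^esub> v = \<zero>\<^bsub>N\<^esub>"
      using z by (simp_all add: M.smult_l_minus N.smult_l_minus M.M.l_neg N.M.l_neg)
    show ?thesis
      by (rule bexI[of _ "(?a \<odot>\<^bsub>M\<^esub> u, ?a \<odot>\<^bsub>N\<^esub> v)"]) (use z neg in \<open>simp_all add: dirsum2_def lin\<close>)
  qed
  then have "abelian_group ?E"
    by (intro abelian_groupI)
      (auto simp: dirsum2_def lin zero M.M.a_ac N.M.a_ac)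
  then show ?thesis
    by (intro moduleI M.R.cring_axioms)
      (auto simp: dirsum2_def lin M.smult_l_distr N.smult_l_distr M.smult_r_distr N.smult_r_distr
        M.smult_assoc1 N.smult_assoc1)
qed

lemma module_zero_submodule:
  assumes "module k M"
  shows "module k (M \<lparr> carrier := {\<zero>\<^bsub>M\<^esub>} \<rparr>)"
proof -
  interpret M: module k M by fact
  have "abelian_group (M \<lparr> carrier := {\<zero>\<^bsub>M\<^esub>} \<rparr>)" by (rule abelian_groupI) auto
  then show ?thesis by (intro moduleI M.R.cring_axioms) auto
qed

lemma fibre_product_simps:
  "(x, y) \<in> obj (fibre_product C D F G) \<longleftrightarrow> x \<in> obj C \<and> y \<in> obj D \<and> fobj F x = fobj G y"
  "mor (fibre_product C D F G) (x, y) (x', y') =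
     (dirsum2 (mor C x x') (mor D y y')) \<lparr> carrier := {(u, v). u \<in> carrier (mor C x x') \<and>
       v \<in> carrier (mor D y y') \<and> fmor F x x' u = fmor G y y' v} \<rparr>"
  "cmp (fibre_product C D F G) (x, y) (x', y') (x'', y'') (u', v') (u, v) =
     (cmp C x x' x'' u' u, cmp D y y' y'' v' v)"
  "idn (fibre_product C D F G) (x, y) = (idn C x, idn D y)"
  by (auto simp: fibre_product_def)

lemma fibre_product_dmor:
  "(u, v) \<in> carrier (dmor (fibre_product C D F G) d (x, y) (x', y')) \<longleftrightarrow>
     u \<in> carrier (dmor C d x x') \<and> v \<in> carrier (dmor D d y y') \<and> dfmor F d x x' u = dfmor G d y y' v"
  "\<zero>\<^bsub>dmor (fibre_product C D F G) d (x, y) (x', y')\<^esub> = (\<zero>\<^bsub>dmor C d x x'\<^esub>, \<zero>\<^bsub>dmor D d y y'\<^esub>)"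
  by (auto simp: dmor_def dfmor_def fibre_product_simps dirsum2_def)

lemma k_category_fibre_product:
  assumes F: "k_functor k C B F" and G: "k_functor k D B G"
  shows "k_category k (fibre_product C D F G)"
proof -
  interpret F: k_functor k C B F by fact
  interpret G: k_functor k D B G by fact
  let ?P = "fibre_product C D F G"
  show ?thesis
  proof (intro k_category.intro F.C.cring_axioms k_category_axioms.intro)
    fix x y assume xy: "x \<in> obj ?P" "y \<in> obj ?P"
    obtain a b a' b' where x: "x = (a, b)" and y: "y = (a', b')" by (metis surj_pair)
    have o: "a \<in> obj C" "b \<in> obj D" "fobj G b = fobj F a" "a' \<in> obj C" "b' \<in> obj D" "fobj G b' = fobj F a'"
      using xy by (auto simp: x y fibre_product_simps)
    show "module k (mor ?P x y)"
      unfolding x y fibre_product_simps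
      by (rule module_equalizer[where P = "mor B (fobj F a) (fobj F a')"])
        (use o F.fobj_closed F.C.mor_module G.C.mor_module F.D.mor_module F.fmor_linear
          G.fmor_linear[of b b'] in simp_all)
  next
    fix x y z f assume "x \<in> obj ?P" "y \<in> obj ?P" "z \<in> obj ?P" "f \<in> carrier (mor ?P x y)"
    then show "klinear k (mor ?P y z) (mor ?P x z) (\<lambda>g. cmp ?P x y z g f)"
      by (cases x; cases y; cases z; cases f)
        (auto simp: fibre_product_simps klinear_def dirsum2_def F.C.cmp_closed G.C.cmp_closed
          F.fmor_cmp G.fmor_cmp
          klinearD[OF F.C.cmp_linear_left] klinearD[OF G.C.cmp_linear_left])
  next
    fix x y z g assume "x \<in> obj ?P" "y \<in> obj ?P" "z \<in> obj ?P" "g \<in> carrier (mor ?P y z)"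
    then show "klinear k (mor ?P x y) (mor ?P x z) (\<lambda>f. cmp ?P x y z g f)"
      by (cases x; cases y; cases z; cases g)
        (auto simp: fibre_product_simps klinear_def dirsum2_def F.C.cmp_closed G.C.cmp_closed
          F.fmor_cmp G.fmor_cmp
          klinearD[OF F.C.cmp_linear_right] klinearD[OF G.C.cmp_linear_right])
  next
    fix w x y z f g h
    assume "w \<in> obj ?P" "x \<in> obj ?P" "y \<in> obj ?P" "z \<in> obj ?P"
      "f \<in> carrier (mor ?P w x)" "g \<in> carrier (mor ?P x y)" "h \<in> carrier (mor ?P y z)"
    then show "cmp ?P w y z h (cmp ?P w x y g f) = cmp ?P w x z (cmp ?P x y z h g) f"
      by (cases w; cases x; cases y; cases z; cases f; cases g; cases h)
        (simp add: fibre_product_simps F.C.cmp_assoc G.C.cmp_assoc)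
  next
    fix x assume "x \<in> obj ?P"
    then show "idn ?P x \<in> carrier (mor ?P x x)"
      by (cases x) (simp add: fibre_product_simps F.C.idn_closed G.C.idn_closed F.fmor_idn G.fmor_idn)
  next
    fix x y f assume "x \<in> obj ?P" "y \<in> obj ?P" "f \<in> carrier (mor ?P x y)"
    then show "cmp ?P x y y (idn ?P y) f = f" "cmp ?P x x y f (idn ?P x) = f"
      by (cases x; cases y; cases f; simp add: fibre_product_simps F.C.cmp_idn_left G.C.cmp_idn_left
          F.C.cmp_idn_right G.C.cmp_idn_right)+
  qed
qed

definition pr_second :: "('o \<times> 'q, 'm \<times> 'l, 'q, 'l) kfun"
  where "pr_second = \<lparr> fobj = snd, fmor = (\<lambda>_ _. snd) \<rparr>"

lemma k_functor_pr:
  assumes F: "k_functor k C B F" and G: "k_functor k D B G"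
  shows "k_functor k (fibre_product C D F G) C pr_first"
    and "k_functor k (fibre_product C D F G) D pr_second"
proof -
  interpret F: k_functor k C B F by fact
  interpret G: k_functor k D B G by fact
  show "k_functor k (fibre_product C D F G) C pr_first"
    by (rule k_functorI[OF k_category_fibre_product[OF F G] F.C.k_category_axioms])
      (auto simp: pr_first_def fibre_product_simps klinear_def dirsum2_def)
  show "k_functor k (fibre_product C D F G) D pr_second"
    by (rule k_functorI[OF k_category_fibre_product[OF F G] G.C.k_category_axioms])
      (auto simp: pr_second_def fibre_product_simps klinear_def dirsum2_def)
qed

lemma kcat_times_simps:
  "(x, e) \<in> obj (kcat_times A E) \<longleftrightarrow> x \<in> obj A \<and> e \<in> E"
  "mor (kcat_times A E) (x, e) (y, e') =
     (if e = e' then mor A x y else (mor A x y) \<lparr> carrier := {\<zero>\<^bsub>mor A x y\<^esub>} \<rparr>)"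
  "cmp (kcat_times A E) (x, e) (y, e') (z, e'') = cmp A x y z"
  "idn (kcat_times A E) (x, e) = idn A x"
  by (auto simp: kcat_times_def)

lemma kcat_times_carrier_subset:
  assumes "k_category k A" "x \<in> obj A" "y \<in> obj A" "f \<in> carrier (mor (kcat_times A E) (x, e) (y, e'))"
  shows "f \<in> carrier (mor A x y)"
  using assms module_zero_closed[OF k_category.mor_module[OF assms(1-3)]]
  by (auto simp: kcat_times_simps split: if_splits)

text \<open>
  The point to check is that composition respects the zero modules between different sheets:
  a composite from sheet \<open>e\<close> to a different sheet \<open>e''\<close> changes sheets at one of its two factors,
  and that factor is zero.
\<close>

lemma k_category_kcat_times:
  assumes "k_category k A"
  shows "k_category k (kcat_times A E)"
proof -
  interpret A: k_category k A by fact
  let ?P = "kcat_times A E"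
  note sub = kcat_times_carrier_subset[OF assms]
  have zl: "cmp A x y z \<zero>\<^bsub>mor A y z\<^esub> f = \<zero>\<^bsub>mor A x z\<^esub>"
    if "x \<in> obj A" "y \<in> obj A" "z \<in> obj A" "f \<in> carrier (mor A x y)" for x y z f
    by (rule klinear_zero[OF _ _ A.cmp_linear_left[OF that]]) (use that A.mor_module in auto)
  have zr: "cmp A x y z g \<zero>\<^bsub>mor A x y\<^esub> = \<zero>\<^bsub>mor A x z\<^esub>"
    if "x \<in> obj A" "y \<in> obj A" "z \<in> obj A" "g \<in> carrier (mor A y z)" for x y z g
    by (rule klinear_zero[OF _ _ A.cmp_linear_right[OF that]]) (use that A.mor_module in auto)
  have closed: "cmp A x y z g f \<in> carrier (mor ?P (x, e) (z, e''))"
    if o: "x \<in> obj A" "y \<in> obj A" "z \<in> obj A"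
      and f: "f \<in> carrier (mor ?P (x, e) (y, e'))" and g: "g \<in> carrier (mor ?P (y, e') (z, e''))"
    for x y z e e' e'' f g
  proof (cases "e = e''")
    case True
    then show ?thesis using A.cmp_closed[OF o sub[OF o(1,2) f] sub[OF o(2,3) g]] by (simp add: kcat_times_simps)
  next
    case False
    then have "e \<noteq> e' \<or> e' \<noteq> e''" by blast
    then have "cmp A x y z g f = \<zero>\<^bsub>mor A x z\<^esub>"
      using f g zl[OF o sub[OF o(1,2) f]] zr[OF o sub[OF o(2,3) g]] by (auto simp: kcat_times_simps)
    then show ?thesis using False by (simp add: kcat_times_simps)
  qed
  show ?thesis
  proof (intro k_category.intro A.cring_axioms k_category_axioms.intro)
    fix x y assume "x \<in> obj ?P" "y \<in> obj ?P"
    then show "module k (mor ?P x y)"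
      by (cases x; cases y) (simp add: kcat_times_simps A.mor_module module_zero_submodule)
  next
    fix x y z f assume *: "x \<in> obj ?P" "y \<in> obj ?P" "z \<in> obj ?P" "f \<in> carrier (mor ?P x y)"
    obtain x0 e y0 e' z0 e'' where [simp]: "x = (x0, e)" "y = (y0, e')" "z = (z0, e'')"
      by (metis surj_pair)
    have o: "x0 \<in> obj A" "y0 \<in> obj A" "z0 \<in> obj A" using * by (simp_all add: kcat_times_simps)
    note lin = klinearD[OF A.cmp_linear_left[OF o sub[OF o(1,2) *(4)[simplified]]]]
    show "klinear k (mor ?P y z) (mor ?P x z) (\<lambda>g. cmp ?P x y z g f)"
    proof (rule klinearI)
      fix g assume "g \<in> carrier (mor ?P y z)"
      then show "cmp ?P x y z g f \<in> carrier (mor ?P x z)"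
        using closed[OF o] *(4) by (simp add: kcat_times_simps(3))
    next
      fix g g' assume "g \<in> carrier (mor ?P y z)" "g' \<in> carrier (mor ?P y z)"
      then have "g \<in> carrier (mor A y0 z0)" "g' \<in> carrier (mor A y0 z0)" using sub[OF o(2,3)] by simp_all
      then show "cmp ?P x y z (g \<oplus>\<^bsub>mor ?P y z\<^esub> g') f = cmp ?P x y z g f \<oplus>\<^bsub>mor ?P x z\<^esub> cmp ?P x y z g' f"
        by (simp add: kcat_times_simps lin)
    next
      fix a g assume "a \<in> carrier k" "g \<in> carrier (mor ?P y z)"
      moreover from this have "g \<in> carrier (mor A y0 z0)" using sub[OF o(2,3)] by simp
      ultimately show "cmp ?P x y z (a \<odot>\<^bsub>mor ?P y z\<^esub> g) f = a \<odot>\<^bsub>mor ?P x z\<^esub> cmp ?P x y z g f"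
        by (simp add: kcat_times_simps lin)
    qed
  next
    fix x y z g assume *: "x \<in> obj ?P" "y \<in> obj ?P" "z \<in> obj ?P" "g \<in> carrier (mor ?P y z)"
    obtain x0 e y0 e' z0 e'' where [simp]: "x = (x0, e)" "y = (y0, e')" "z = (z0, e'')"
      by (metis surj_pair)
    have o: "x0 \<in> obj A" "y0 \<in> obj A" "z0 \<in> obj A" using * by (simp_all add: kcat_times_simps)
    note lin = klinearD[OF A.cmp_linear_right[OF o sub[OF o(2,3) *(4)[simplified]]]]
    show "klinear k (mor ?P x y) (mor ?P x z) (\<lambda>f. cmp ?P x y z g f)"
    proof (rule klinearI)
      fix f assume "f \<in> carrier (mor ?P x y)"
      then show "cmp ?P x y z g f \<in> carrier (mor ?P x z)"
        using closed[OF o] *(4) by (simp add: kcat_times_simps(3))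
    next
      fix f f' assume "f \<in> carrier (mor ?P x y)" "f' \<in> carrier (mor ?P x y)"
      then have "f \<in> carrier (mor A x0 y0)" "f' \<in> carrier (mor A x0 y0)" using sub[OF o(1,2)] by simp_all
      then show "cmp ?P x y z g (f \<oplus>\<^bsub>mor ?P x y\<^esub> f') = cmp ?P x y z g f \<oplus>\<^bsub>mor ?P x z\<^esub> cmp ?P x y z g f'"
        by (simp add: kcat_times_simps lin)
    next
      fix a f assume "a \<in> carrier k" "f \<in> carrier (mor ?P x y)"
      moreover from this have "f \<in> carrier (mor A x0 y0)" using sub[OF o(1,2)] by simp
      ultimately show "cmp ?P x y z g (a \<odot>\<^bsub>mor ?P x y\<^esub> f) = a \<odot>\<^bsub>mor ?P x z\<^esub> cmp ?P x y z g f"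
        by (simp add: kcat_times_simps lin)
    qed
  next
    fix w x y z f g h
    assume *: "w \<in> obj ?P" "x \<in> obj ?P" "y \<in> obj ?P" "z \<in> obj ?P"
      "f \<in> carrier (mor ?P w x)" "g \<in> carrier (mor ?P x y)" "h \<in> carrier (mor ?P y z)"
    obtain w0 d x0 e y0 e' z0 e'' where [simp]: "w = (w0, d)" "x = (x0, e)" "y = (y0, e')" "z = (z0, e'')"
      by (metis surj_pair)
    have o: "w0 \<in> obj A" "x0 \<in> obj A" "y0 \<in> obj A" "z0 \<in> obj A"
      using * by (simp_all add: kcat_times_simps)
    show "cmp ?P w y z h (cmp ?P w x y g f) = cmp ?P w x z (cmp ?P x y z h g) f"
      using A.cmp_assoc[OF o sub[OF o(1,2)] sub[OF o(2,3)] sub[OF o(3,4)]] *(5-7)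
      by (simp add: kcat_times_simps(3))
  next
    fix x assume "x \<in> obj ?P"
    then show "idn ?P x \<in> carrier (mor ?P x x)"
      by (cases x) (simp add: kcat_times_simps A.idn_closed)
  next
    fix x y f assume *: "x \<in> obj ?P" "y \<in> obj ?P" "f \<in> carrier (mor ?P x y)"
    obtain x0 e y0 e' where [simp]: "x = (x0, e)" "y = (y0, e')" by (metis surj_pair)
    have o: "x0 \<in> obj A" "y0 \<in> obj A" using * by (simp_all add: kcat_times_simps)
    have "f \<in> carrier (mor A x0 y0)" using sub[OF o] *(3) by simp
    then show "cmp ?P x y y (idn ?P y) f = f" "cmp ?P x x y f (idn ?P x) = f"
      using A.cmp_idn_left[OF o] A.cmp_idn_right[OF o] by (simp_all add: kcat_times_simps)
  qed
qed

text \<open>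
  The sheet of the trivial covering indexed by \<open>e\<close>, as a functor from the base.
\<close>

definition kcat_times_incl :: "'e \<Rightarrow> ('o, 'm, 'o \<times> 'e, 'm) kfun"
  where "kcat_times_incl e = \<lparr> fobj = (\<lambda>x. (x, e)), fmor = (\<lambda>_ _ f. f) \<rparr>"

lemma k_functor_kcat_times_incl:
  assumes "k_category k A" "e \<in> E"
  shows "k_functor k A (kcat_times A E) (kcat_times_incl e)"
  by (rule k_functorI[OF assms(1) k_category_kcat_times[OF assms(1)]])
    (auto simp: kcat_times_incl_def kcat_times_simps klinear_def assms(2))

section \<open>Galois coverings and the fibre product\<close>

context kcovering
begin

text \<open>
  A deck endofunctor \<open>T\<close> has its graph in this category, consisting of the objects \<open>(x, T x)\<close> and the morphisms \<open>(u, T u)\<close>.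
\<close>

abbreviation square :: "('k, 'o \<times> 'o, 'm \<times> 'm) kcat"
  where "square \<equiv> fibre_product C C F F"

text \<open>
  No non-zero morphism of the fibre product joins an object of the graph of \<open>T\<close> to an object
  outside it, and the morphisms between objects of the graph belong to the graph.  Indeed \<open>v\<close> and \<open>T u\<close> are
  homogeneous lifts of \<open>F u = F v\<close> at the same object.
\<close>

lemma square_morphism_graph:
  assumes T: "deck_endo k C F T" and x: "x \<in> obj C" and x': "x' \<in> obj C" and y': "y' \<in> obj C"
    and y'_over: "fobj F y' = fobj F x'"
    and uv: "(u, v) \<in> carrier (dmor square d (x, fobj T x) (x', y'))"
  shows "y' = fobj T x' \<Longrightarrow> v = dfmor T d x x' u"
    and "y' \<noteq> fobj T x' \<Longrightarrow> u = \<zero>\<^bsub>dmor C d x x'\<^esub> \<and> v = \<zero>\<^bsub>dmor C d (fobj T x) y'\<^esub>"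
proof -
  have u: "u \<in> carrier (dmor C d x x')" and v: "v \<in> carrier (dmor C d (fobj T x) y')"
    and eq: "dfmor F d x x' u = dfmor F d (fobj T x) y' v"
    using uv by (auto simp: fibre_product_dmor)
  note Tx = deck_endo_fobj[OF T x] and Tx' = deck_endo_fobj[OF T x'] and Tu = deck_endo_dfmor[OF T x x' u]
  show "v = dfmor T d x x' u" if "y' = fobj T x'"
    by (rule faithful[OF Tx(1) y' v]) (use Tu eq that in simp_all)
  assume ne: "y' \<noteq> fobj T x'"
  have v0: "v = \<zero>\<^bsub>dmor C d (fobj T x) y'\<^esub>"
    by (rule lift_target_unique[OF Tx(1) y' Tx'(1) _ _ v Tu(1)]) (use Tu(2) Tx' y'_over eq ne in simp_all)
  have "dfmor F d x x' u = dfmor F d x x' \<zero>\<^bsub>dmor C d x x'\<^esub>"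
    using eq v0 dfmor_zero[OF Tx(1) y'] dfmor_zero[OF x x'] y'_over Tx(2) by simp
  then have "u = \<zero>\<^bsub>dmor C d x x'\<^esub>"
    using faithful[OF x x' u module_zero_closed[OF C.dmor_module[OF x x']]] by blast
  then show "u = \<zero>\<^bsub>dmor C d x x'\<^esub> \<and> v = \<zero>\<^bsub>dmor C d (fobj T x) y'\<^esub>" using v0 by blast
qed

lemma bij_betw_square_graph:
  assumes T: "deck_endo k C F T" and x: "x \<in> obj C" and x': "x' \<in> obj C"
  shows "bij_betw fst (carrier (dmor square d (x, fobj T x) (x', fobj T x'))) (carrier (dmor C d x x'))"
proof (rule bij_betw_byWitness[of _ "\<lambda>u. (u, dfmor T d x x' u)"])
  note Tx' = deck_endo_fobj[OF T x']
  show "\<forall>w\<in>carrier (dmor square d (x, fobj T x) (x', fobj T x')). (fst w, dfmor T d x x' (fst w)) = w"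
    using square_morphism_graph(1)[OF T x x' Tx'] by (auto simp: split_paired_all)
  show "fst ` carrier (dmor square d (x, fobj T x) (x', fobj T x')) \<subseteq> carrier (dmor C d x x')"
    by (auto simp: fibre_product_dmor split_paired_all)
  show "(\<lambda>u. (u, dfmor T d x x' u)) ` carrier (dmor C d x x')
      \<subseteq> carrier (dmor square d (x, fobj T x) (x', fobj T x'))"
    using deck_endo_dfmor[OF T x x'] by (auto simp: fibre_product_dmor)
qed simp

text \<open>
  When the deck transformations are transitive on all fibres, their graphs fill the fibre product.
\<close>

lemma square_obj_graph:
  assumes full: "\<forall>x\<in>obj C. orbit_is_fibre x" and "w \<in> obj square"
  obtains x T where "x \<in> obj C" "T \<in> Aut1 k C F" "w = (x, fobj T x)"
proof -
  obtain x y where "w = (x, y)" by fastforce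
  then show thesis
    using assms that by (fastforce simp: orbit_is_fibre_def fibre_def fibre_product_simps)
qed

lemma graph_square_obj:
  assumes "deck_endo k C F T" "x \<in> obj C"
  shows "(x, fobj T x) \<in> obj square"
  using deck_endo_fobj[OF assms] assms(2) by (simp add: fibre_product_simps)

text \<open>
  Pulling a covering back need not give a covering, because two lifts of a morphism may decompose
  differently.  Here it does: a morphism \<open>u\<close> of the base lifts at \<open>(x, T x)\<close> to the single
  morphism \<open>(u, T u)\<close>.
\<close>

lemma covering_pr_first_square:
  assumes full: "\<forall>x\<in>obj C. orbit_is_fibre x"
  shows "k_covering k square C pr_first"
proof -
  interpret pr: k_functor k square C pr_first by (rule k_functor_pr[OF k_functor_axioms k_functor_axioms])
  have dpr: "dfmor pr_first d w w' = fst" "fobj pr_first w = fst w"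
    for d and w w' :: "'o \<times> 'o" by (auto simp: dfmor_def pr_first_def)
  show ?thesis
  proof (rule pr.covering_if_concentrated)
    show "fobj pr_first ` obj square = obj C"
      using graph_square_obj[OF deck_endo_id] by (force simp: dpr fibre_product_def)
  next
    fix w x' assume w: "w \<in> obj square" and x': "x' \<in> obj C"
    obtain x T where x: "x \<in> obj C" and "T \<in> Aut1 k C F" and w_eq: "w = (x, fobj T x)"
      using square_obj_graph[OF full w] .
    then have T: "deck_endo k C F T" by (simp add: Aut1_deck_endo)
    have "carrier (dmor square d w z) = {\<zero>\<^bsub>dmor square d w z\<^esub>}"
      if z: "z \<in> obj square" "fst z = x'" "z \<noteq> (x', fobj T x')" for d z
    proof -
      obtain y' where z_eq: "z = (x', y')" using z by (metis prod.collapse)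
      have y': "y' \<in> obj C" "fobj F y' = fobj F x'" "y' \<noteq> fobj T x'"
        using z by (auto simp: z_eq fibre_product_simps)
      have "carrier (dmor square d w z) \<subseteq> {\<zero>\<^bsub>dmor square d w z\<^esub>}"
        unfolding w_eq z_eq
        using square_morphism_graph(2)[OF T x x' y'(1,2) _ y'(3)]
        by (auto simp: fibre_product_dmor(2) split_paired_all)
      then show ?thesis using module_zero_closed[OF pr.C.dmor_module[OF w z(1)]] by blast
    qed
    then show "\<exists>y\<in>obj square. fobj pr_first y = x' \<and>
      (\<forall>d. bij_betw (dfmor pr_first d w y) (carrier (dmor square d w y)) (carrier (dmor C d (fobj pr_first w) x')) \<and>
           (\<forall>z\<in>obj square. fobj pr_first z = x' \<and> z \<noteq> y \<longrightarrow>
             carrier (dmor square d w z) = {\<zero>\<^bsub>dmor square d w z\<^esub>}))"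
      using bij_betw_square_graph[OF T x x'] w_eq
      by (intro bexI[of _ "(x', fobj T x')"] graph_square_obj[OF T x']) (simp_all add: dpr)
  qed
qed

text \<open>
  The fibre product is the disjoint union of the graphs of the deck transformations, and the first
  projection maps each graph isomorphically to \<open>C\<close>.  By uniqueness of lifts a deck transformation
  is determined by its value at a base point \<open>x0\<close>, so the fibre through \<open>x0\<close> can index the sheets.
  The trivialisation sends \<open>(x, T x)\<close> to \<open>x\<close> on the sheet \<open>T x0\<close>.
\<close>

lemma trivial_if_orbits_are_fibres:
  assumes conn: "kcat_connected C" and ne: "obj B \<noteq> {}" and full: "\<forall>x\<in>obj C. orbit_is_fibre x"
  shows "trivial_covering k square C pr_first"
proof -
  have "obj C \<noteq> {}" using covering ne by (auto simp: k_covering_def)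
  then obtain x0 where x0: "x0 \<in> obj C" by blast
  \<comment> \<open>The first component \<open>x0\<close> is a dummy: the index set has to live in the type of pairs of objects.\<close>
  define E where "E = {x0} \<times> fibre C F (fobj F x0)"
  \<comment> \<open>The choice of a deck transformation through \<open>w\<close> does not matter, as two of them agree on \<open>C\<close>.\<close>
  define label where "label w = (x0, fobj (SOME T. T \<in> Aut1 k C F \<and> fobj T (fst w) = snd w) x0)"
    for w :: "'o \<times> 'o"
  have label: "label (x, fobj T x) = (x0, fobj T x0)" if T: "T \<in> Aut1 k C F" and x: "x \<in> obj C" for T x
  proof -
    define S where "S = (SOME S. S \<in> Aut1 k C F \<and> fobj S x = fobj T x)"
    have "S \<in> Aut1 k C F \<and> fobj S x = fobj T x" unfolding S_def by (rule someI[of _ T]) (use T in blast)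
    then have "kfun_eq C S T" using deck_endo_unique[OF conn _ _ x] T Aut1_deck_endo by blast
    then show ?thesis using x0 by (simp add: label_def S_def kfun_eq_def)
  qed
  have label_eq: "fobj S x = fobj T x"
    if "S \<in> Aut1 k C F" "T \<in> Aut1 k C F" "fobj S x0 = fobj T x0" "x \<in> obj C" for S T x
    using deck_endo_unique[OF conn _ _ x0 that(3)] that Aut1_deck_endo by (auto simp: kfun_eq_def)
  define H :: "('o \<times> 'o, 'm \<times> 'm, 'o \<times> ('o \<times> 'o), 'm) kfun"
    where "H = \<lparr> fobj = (\<lambda>w. (fst w, label w)), fmor = (\<lambda>_ _. fst) \<rparr>"
  have H: "fobj H w = (fst w, label w)" "fmor H w w' = fst" for w w' by (simp_all add: H_def)
  have bij_mor: "bij_betw fst (carrier (mor square w w')) (carrier (mor (kcat_times C E) (fobj H w) (fobj H w')))"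
    if w: "w \<in> obj square" and w': "w' \<in> obj square" for w w'
  proof -
    obtain x T where x: "x \<in> obj C" and T: "T \<in> Aut1 k C F" and w_eq: "w = (x, fobj T x)"
      using square_obj_graph[OF full w] .
    obtain x' T' where x': "x' \<in> obj C" and T': "T' \<in> Aut1 k C F" and w'_eq: "w' = (x', fobj T' x')"
      using square_obj_graph[OF full w'] .
    note dT = Aut1_deck_endo[OF T]
    show ?thesis
    proof (cases "fobj T x0 = fobj T' x0")
      case True
      then have "w' = (x', fobj T x')" using label_eq[OF T T' True x'] w'_eq by simp
      then show ?thesis
        using bij_betw_square_graph[OF dT x x', of True] label[OF T x] label[OF T x']
        by (simp add: w_eq H kcat_times_simps dmor_def)
    next
      case False
      have y': "fobj T' x' \<in> obj C" "fobj F (fobj T' x') = fobj F x'"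
        using deck_endo_fobj[OF Aut1_deck_endo[OF T'] x'] .
      have ne: "fobj T' x' \<noteq> fobj T x'"
        using label[OF T' x'] label[OF T x'] False by auto
      have "carrier (mor square w w') \<subseteq> {\<zero>\<^bsub>mor square w w'\<^esub>}"
        using square_morphism_graph(2)[OF dT x x' y' _ ne, where d = True]
        by (auto simp: w_eq w'_eq dmor_def fibre_product_simps dirsum2_def)
      then have "carrier (mor square w w') = {\<zero>\<^bsub>mor square w w'\<^esub>}"
        using module_zero_closed k_category.mor_module[OF k_category_fibre_product w w', of k B]
          k_functor_axioms by blast
      moreover have "carrier (mor (kcat_times C E) (fobj H w) (fobj H w')) = {\<zero>\<^bsub>mor C x x'\<^esub>}"
        using False label[OF T x] label[OF T' x'] by (simp add: w_eq w'_eq H kcat_times_simps)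
      moreover have "fst \<zero>\<^bsub>mor square w w'\<^esub> = \<zero>\<^bsub>mor C x x'\<^esub>"
        by (simp add: w_eq w'_eq fibre_product_simps dirsum2_def)
      ultimately show ?thesis by (simp add: bij_betw_def)
    qed
  qed
  have bij_obj: "bij_betw (fobj H) (obj square) (obj (kcat_times C E))"
    unfolding bij_betw_def
  proof (intro conjI inj_onI equalityI subsetI)
    fix w w' assume w: "w \<in> obj square" "w' \<in> obj square" and eq: "fobj H w = fobj H w'"
    obtain x T where x: "x \<in> obj C" and T: "T \<in> Aut1 k C F" and w_eq: "w = (x, fobj T x)"
      using square_obj_graph[OF full w(1)] .
    obtain x' T' where x': "x' \<in> obj C" and T': "T' \<in> Aut1 k C F" and w'_eq: "w' = (x', fobj T' x')"
      using square_obj_graph[OF full w(2)] .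
    have "x = x'" "fobj T x0 = fobj T' x0"
      using eq label[OF T x] label[OF T' x'] by (simp_all add: H w_eq w'_eq)
    then show "w = w'" using label_eq[OF T T' _ x] w_eq w'_eq by simp
  next
    fix z assume "z \<in> fobj H ` obj square"
    then obtain w where w: "w \<in> obj square" "z = fobj H w" by blast
    obtain x T where x: "x \<in> obj C" and T: "T \<in> Aut1 k C F" and w_eq: "w = (x, fobj T x)"
      using square_obj_graph[OF full w(1)] .
    show "z \<in> obj (kcat_times C E)"
      using w(2) x label[OF T x] deck_endo_fobj[OF Aut1_deck_endo[OF T] x0]
      by (simp add: H w_eq kcat_times_simps E_def fibre_def)
  next
    fix z assume "z \<in> obj (kcat_times C E)"
    then obtain x y0 where z: "z = (x, (x0, y0))" "x \<in> obj C" "y0 \<in> fibre C F (fobj F x0)"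
      by (cases z) (auto simp: kcat_times_simps E_def)
    obtain T where T: "T \<in> Aut1 k C F" "fobj T x0 = y0"
      using full x0 z(3) by (auto simp: orbit_is_fibre_def)
    have "z = fobj H (x, fobj T x)" using label[OF T(1) z(2)] T(2) z(1) by (simp add: H)
    then show "z \<in> fobj H ` obj square" using graph_square_obj[OF Aut1_deck_endo[OF T(1)] z(2)] by blast
  qed
  interpret sq: k_category k square by (rule k_category_fibre_product[OF k_functor_axioms k_functor_axioms])
  have "k_functor k square (kcat_times C E) H"
  proof (rule k_functorI)
    fix w w' assume w: "w \<in> obj square" "w' \<in> obj square"
    obtain x y x' y' where [simp]: "w = (x, y)" "w' = (x', y')" by (metis surj_pair)
    show "klinear k (mor square w w') (mor (kcat_times C E) (fobj H w) (fobj H w')) (fmor H w w')"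
    proof (rule klinearI)
      fix u assume "u \<in> carrier (mor square w w')"
      then show "fmor H w w' u \<in> carrier (mor (kcat_times C E) (fobj H w) (fobj H w'))"
        using bij_betwE[OF bij_mor[OF w]] by (simp add: H)
    qed (auto simp: H kcat_times_simps fibre_product_simps dirsum2_def)
  qed (use bij_betwE[OF bij_obj] in \<open>auto simp: sq.k_category_axioms k_category_kcat_times[OF C.k_category_axioms]
      H kcat_times_simps fibre_product_simps split_paired_all\<close>)
  then have "kcat_iso k square (kcat_times C E) H"
    by (rule kcat_isoI[OF _ bij_obj]) (use bij_mor in \<open>simp add: H\<close>)
  moreover have "kfun_eq square (comp_kfun kcat_times_proj H) (comp_kfun id_kfun pr_first)"
    by (auto simp: kfun_eq_def comp_kfun_def kcat_times_proj_def id_kfun_def pr_first_def H)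
  ultimately have "isomorphic_coverings k C square pr_first (kcat_times C E) kcat_times_proj"
    using kcat_iso_id[OF C.k_category_axioms]
    unfolding isomorphic_coverings_def covering_morphism_def kcat_iso_def by blast
  then show ?thesis
    using covering_pr_first_square[OF full] unfolding trivial_covering_def by blast
qed

text \<open>
  The sheet through \<open>(x, y)\<close> of a trivialisation \<open>H\<close> gives a section of the first projection;
  followed by the second projection, it is an endofunctor that sends \<open>x\<close> to \<open>y\<close>.  It commutes
  with \<open>F\<close> because \<open>F pr\<^sub>2 = F pr\<^sub>1\<close> on the fibre product.  The automorphism \<open>J\<close> of the base that an
  isomorphism of coverings may involve is absorbed by precomposing the sheet with it.
\<close>

lemma deck_endo_if_trivial:
  assumes triv: "trivial_covering k square C pr_first"
    and x: "x \<in> obj C" and y: "y \<in> obj C" and xy: "fobj F x = fobj F y"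
  shows "\<exists>T. deck_endo k C F T \<and> fobj T x = y"
proof -
  obtain E :: "('o \<times> 'o) set" and H J where H: "k_functor k square (kcat_times C E) H"
    and J: "kcat_iso k C C J"
    and comm: "kfun_eq square (comp_kfun kcat_times_proj H) (comp_kfun J pr_first)"
    and iso: "kcat_iso k square (kcat_times C E) H"
    using triv unfolding trivial_covering_def isomorphic_coverings_def covering_morphism_def by blast
  obtain H' where H': "k_functor k (kcat_times C E) square H'"
    and H'H: "kfun_eq square (comp_kfun H' H) id_kfun" and HH': "kfun_eq (kcat_times C E) (comp_kfun H H') id_kfun"
    using iso unfolding kcat_iso_def by blast
  obtain J' where Jf: "k_functor k C C J" and J'J: "kfun_eq C (comp_kfun J' J) id_kfun"
    using J unfolding kcat_iso_def by blast
  interpret H: k_functor k square "kcat_times C E" H by fact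
  have w: "(x, y) \<in> obj square" using x y xy by (simp add: fibre_product_simps)
  define e where "e = snd (fobj H (x, y))"
  have Hw: "fobj H (x, y) = (fobj J x, e)"
    using comm w by (auto simp: kfun_eq_def comp_kfun_def kcat_times_proj_def pr_first_def e_def prod_eq_iff)
  have e: "e \<in> E" using H.fobj_closed[OF w] by (simp add: Hw kcat_times_simps)
  \<comment> \<open>The section: \<open>J pr\<^sub>1 R = pr H H' incl J = J\<close>, hence \<open>pr\<^sub>1 R\<close> is the identity.\<close>
  define R where "R = comp_kfun H' (comp_kfun (kcat_times_incl e) J)"
  have incl: "k_functor k C (kcat_times C E) (comp_kfun (kcat_times_incl e) J)"
    by (rule k_functor_comp[OF Jf k_functor_kcat_times_incl[OF C.k_category_axioms e]])
  then have R: "k_functor k C square R" unfolding R_def using H' by (rule k_functor_comp)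
  interpret incl: k_functor k C "kcat_times C E" "comp_kfun (kcat_times_incl e) J" by fact
  interpret R: k_functor k C square R by fact
  have HR: "fobj H (fobj R z) = (fobj J z, e)" if "z \<in> obj C" for z
    using HH' incl.fobj_closed[OF that]
    by (simp add: R_def kfun_eq_def comp_kfun_def id_kfun_def kcat_times_incl_def)
  have HRm: "fmor H (fobj R z) (fobj R z') (fmor R z z' f) = fmor J z z' f"
    if "z \<in> obj C" "z' \<in> obj C" "f \<in> carrier (mor C z z')" for z z' f
    using HH' incl.fobj_closed[OF that(1)] incl.fobj_closed[OF that(2)] incl.fmor_closed[OF that]
    by (simp add: R_def kfun_eq_def comp_kfun_def id_kfun_def kcat_times_incl_def)
  have comm_obj: "fobj J (fst v) = fst (fobj H v)" if "v \<in> obj square" for v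
    using comm that by (simp add: kfun_eq_def comp_kfun_def kcat_times_proj_def pr_first_def)
  have comm_mor: "fmor J (fst v) (fst v') (fst h) = fmor H v v' h"
    if "v \<in> obj square" "v' \<in> obj square" "h \<in> carrier (mor square v v')" for v v' h
    using comm that by (simp add: kfun_eq_def comp_kfun_def kcat_times_proj_def pr_first_def)
  have J'J_obj: "fobj J' (fobj J z) = z" if "z \<in> obj C" for z
    using J'J that by (simp add: kfun_eq_def comp_kfun_def id_kfun_def)
  have fstR: "fst (fobj R z) = z" if z: "z \<in> obj C" for z
  proof -
    have "fst (fobj R z) \<in> obj C" using R.fobj_closed[OF z] by (cases "fobj R z") (simp add: fibre_product_simps)
    moreover have "fobj J (fst (fobj R z)) = fobj J z"
      using comm_obj[OF R.fobj_closed[OF z]] HR[OF z] by simp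
    ultimately show ?thesis using J'J_obj z by metis
  qed
  have fstRm: "fst (fmor R z z' f) = f" if z: "z \<in> obj C" "z' \<in> obj C" "f \<in> carrier (mor C z z')" for z z' f
  proof -
    have cl: "fst (fmor R z z' f) \<in> carrier (mor C z z')"
      using R.fmor_closed[OF z] fstR[OF z(1)] fstR[OF z(2)]
      by (cases "fobj R z"; cases "fobj R z'"; cases "fmor R z z' f") (simp add: fibre_product_simps)
    have "fmor J (fst (fobj R z)) (fst (fobj R z')) (fst (fmor R z z' f)) = fmor J z z' f"
      using comm_mor[OF R.fobj_closed[OF z(1)] R.fobj_closed[OF z(2)] R.fmor_closed[OF z]] HRm[OF z] by simp
    then have "fmor J' (fobj J z) (fobj J z') (fmor J z z' (fst (fmor R z z' f))) =
        fmor J' (fobj J z) (fobj J z') (fmor J z z' f)"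
      using fstR z by simp
    then show ?thesis
      using J'J z cl unfolding kfun_eq_def comp_kfun_def id_kfun_def by simp
  qed
  define T where "T = comp_kfun pr_second R"
  have "k_functor k C C T"
    unfolding T_def by (rule k_functor_comp[OF R k_functor_pr(2)[OF k_functor_axioms k_functor_axioms]])
  moreover have "kfun_eq C (comp_kfun F T) F"
    unfolding kfun_eq_def
  proof (intro conjI ballI)
    fix z assume z: "z \<in> obj C"
    show "fobj (comp_kfun F T) z = fobj F z"
      using R.fobj_closed[OF z] fstR[OF z]
      by (cases "fobj R z") (simp add: T_def comp_kfun_def pr_second_def fibre_product_simps)
  next
    fix z z' f assume z: "z \<in> obj C" "z' \<in> obj C" "f \<in> carrier (mor C z z')"
    show "fmor (comp_kfun F T) z z' f = fmor F z z' f"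
      using R.fmor_closed[OF z] fstR[OF z(1)] fstR[OF z(2)] fstRm[OF z]
      by (cases "fobj R z"; cases "fobj R z'"; cases "fmor R z z' f")
        (simp add: T_def comp_kfun_def pr_second_def fibre_product_simps)
  qed
  moreover have "fobj T x = y"
  proof -
    have "fobj H' (fobj H (x, y)) = (x, y)"
      using H'H w by (simp add: kfun_eq_def comp_kfun_def id_kfun_def)
    then show ?thesis by (simp add: Hw T_def R_def comp_kfun_def kcat_times_incl_def pr_second_def)
  qed
  ultimately show ?thesis unfolding deck_endo_def by blast
qed

text \<open>
  The sheets through \<open>(x, y)\<close> and \<open>(y, x)\<close> give endofunctors that undo each other at \<open>x\<close>,
  so they are deck transformations.
\<close>

lemma orbits_are_fibres_if_trivial:
  assumes conn: "kcat_connected C" and triv: "trivial_covering k square C pr_first" and x: "x \<in> obj C"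
  shows "orbit_is_fibre x"
  unfolding orbit_is_fibre_def
proof
  fix y assume "y \<in> fibre C F (fobj F x)"
  then have y: "y \<in> obj C" "fobj F y = fobj F x" by (auto simp: fibre_def)
  obtain T where T: "deck_endo k C F T" "fobj T x = y"
    using deck_endo_if_trivial[OF triv x y(1)] y(2) by auto
  obtain S where S: "deck_endo k C F S" "fobj S y = x"
    using deck_endo_if_trivial[OF triv y(1) x y(2)] by auto
  show "\<exists>H\<in>Aut1 k C F. fobj H x = y"
    using deck_endo_Aut1[OF conn T(1) S(1) x] T(2) S(2) by auto
qed

end

theorem theorem3p9:
  fixes k :: "'k ring"
    and C :: "('k, 'o, 'm) kcat"
    and B :: "('k, 'p, 'n) kcat"
    and F :: "('o, 'm, 'p, 'n) kfun"
  assumes "cring k"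
    and "k_category k C"
    and "k_category k B"
    and "obj B \<noteq> {}"
    and "connected_covering k C B F"
  shows "galois_covering k C B F \<longleftrightarrow>
         trivial_covering k (fibre_product C C F F) C pr_first"
proof -
  have cov: "k_covering k C B F" and conn: "kcat_connected C"
    using assms(5) by (auto simp: connected_covering_def)
  interpret kcovering k C B F
    using cov by (intro kcovering.intro kcovering_axioms.intro) (auto simp: k_covering_def)
  show ?thesis
    using galois_iff_all_orbits_are_fibres[OF conn assms(4)]
      trivial_if_orbits_are_fibres[OF conn assms(4)] orbits_are_fibres_if_trivial[OF conn] by blast
qed

end
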